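(* For all integers $k\ge 3$ and $n\ge 0$, \begin{align*} c\phi_{9}\Big(3^{2k+1}n+\tfrac{7\cdot 3^{2k+1}+3}{8} \Big) &\equiv 0 \pmod{3^{4k+5}},\\ c\phi_{9}\Big(3^{2k+2}n+\tfrac{5\cdot 3^{2k+2}+3}{8} \Big) &\equiv 0 \pmod{3^{4k+6}},\\ c\phi_{9}\Big(3^{2k+2}n+\tfrac{23\cdot 3^{2k+1}+3}{8}\Big) &\equiv 0 \pmod{3^{4k+7}},\\ c\phi_{9}\Big(3^{2k+3}n+\tfrac{13\cdot 3^{2k+2}+3}{8}\Big) &\equiv 0 \pmod{3^{4k+8}}. \end{align*}
   Context: For a positive integer $k$, color each nonnegative integer with each of $k$ colors $1,\dots,k$, writing $a_c$ for $a$ with color $c$, and order colored integers by $0_1\prec 0_2\prec\cdots\prec 0_k\prec 1_1\prec\cdots\prec 1_k\prec 2_1\prec\cdots$. A $k$-colored generalized Frobenius partition of $n$ is a two-row array $\begin{pmatrix} a_1,\dots,a_r\\ b_1,\dots,b_r\end{pmatrix}$ of colored integers with $a_r\prec a_{r-1}\prec\cdots\prec a_1$ and $b_r\prec\cdots\prec b_1$ and $n=r+\sum_{i=1}^r(a_i+b_i)$ (the sum using the underlying integers). $c\phi_k(n)$ denotes the number of $k$-colored generalized Frobenius partitions of $n$. Equivalently, $\sum_{n\ge0}c\phi_k(n)q^n=\frac{1}{(q;q)_\infty^k}\sum_{m_1,\dots,m_{k-1}\in\mathbb{Z}}q^{\sum_i m_i^2+\sum_{i<j}m_im_j}$, where $(q;q)_\infty=\prod_{n\ge1}(1-q^n)$.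 *)

theory Defs
  imports "HOL-Number_Theory.Cong"
begin

text \<open>
  A colored integer \<open>a\<^sub>c\<close> is the pair \<open>(a, c)\<close> of the underlying nonnegative integer
  and its color.
\<close>

type_synonym colored_nat = "nat \<times> nat"

definition colored_nats :: "nat \<Rightarrow> colored_nat set" where
  "colored_nats k = {(a, c). 1 \<le> c \<and> c \<le> k}"

definition colored_less :: "colored_nat \<Rightarrow> colored_nat \<Rightarrow> bool" (infix "\<prec>" 50) where
  "x \<prec> y \<longleftrightarrow> fst x < fst y \<or> (fst x = fst y \<and> snd x < snd y)"

definition gfp_row :: "nat \<Rightarrow> colored_nat list \<Rightarrow> bool" where
  "gfp_row k xs \<longleftrightarrow> set xs \<subseteq> colored_nats k \<and> sorted_wrt (\<lambda>x y. y \<prec> x) xs"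

text \<open>The case \<open>r = 0\<close> (two empty rows) is allowed; it is the only array for \<open>n = 0\<close>.\<close>

definition gen_frobenius_partitions ::
    "nat \<Rightarrow> nat \<Rightarrow> (colored_nat list \<times> colored_nat list) set" where
  "gen_frobenius_partitions k n =
     {(as, bs). length as = length bs \<and> gfp_row k as \<and> gfp_row k bs \<and>
        n = length as + (\<Sum>i<length as. fst (as ! i) + fst (bs ! i))}"

definition cphi :: "nat \<Rightarrow> nat \<Rightarrow> nat" where
  "cphi k n = card (gen_frobenius_partitions k n)"

text \<open>So the cardinality above is that of a finite set.\<close>

lemma finite_gen_frobenius_partitions: "finite (gen_frobenius_partitions k n)"
proof -
  let ?X = "{xs. set xs \<subseteq> {..n} \<times> {..k} \<and> length xs \<le> n}"
  have "gen_frobenius_partitions k n \<subseteq> ?X \<times> ?X"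
  proof (rule subsetI)
    fix p assume "p \<in> gen_frobenius_partitions k n"
    then obtain as bs where p: "p = (as, bs)" and len: "length as = length bs"
      and rows: "set as \<subseteq> colored_nats k" "set bs \<subseteq> colored_nats k"
      and n: "n = length as + (\<Sum>i<length as. fst (as ! i) + fst (bs ! i))"
      by (auto simp: gen_frobenius_partitions_def gfp_row_def)
    have le: "fst (as ! i) + fst (bs ! i) \<le> n" if "i < length as" for i
    proof -
      have "fst (as ! i) + fst (bs ! i) \<le> (\<Sum>i<length as. fst (as ! i) + fst (bs ! i))"
        by (rule member_le_sum[of i "{..<length as}" "\<lambda>i. fst (as ! i) + fst (bs ! i)"])
           (use that in auto)
      then show ?thesis using n by linarith
    qed
    have fa: "fst x \<le> n" if "x \<in> set as" for x
      using that le by (metis add_leD1 in_set_conv_nth)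
    have fb: "fst x \<le> n" if "x \<in> set bs" for x
      using that le len by (metis add_leD2 in_set_conv_nth)
    have "set as \<subseteq> {..n} \<times> {..k}"
      using rows(1) fa by (force simp: colored_nats_def)
    moreover have "set bs \<subseteq> {..n} \<times> {..k}"
      using rows(2) fb by (force simp: colored_nats_def)
    moreover have "length as \<le> n" using n by linarith
    ultimately show "p \<in> ?X \<times> ?X" using p len by simp
  qed
  moreover have "finite (?X \<times> ?X)"
    by (intro finite_cartesian_product finite_lists_length_le) simp_all
  ultimately show ?thesis by (rule finite_subset)
qed

text \<open>The divisions by 8 in the arguments of \<open>cphi 9\<close> in the theorem are exact.\<close>

lemma pow3_mod_8: "3 ^ (2 * k) mod 8 = (1 :: nat)"
proof -
  have "[(9 :: nat) ^ k = 1 ^ k] (mod 8)" by (rule cong_pow) (simp add: cong_def)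
  then show ?thesis by (simp add: cong_def power_mult)
qed

lemma eight_dvd_args:
  fixes k :: nat
  shows "8 dvd 7 * 3 ^ (2 * k + 1) + (3 :: nat)"
    and "8 dvd 5 * 3 ^ (2 * k + 2) + (3 :: nat)"
    and "8 dvd 23 * 3 ^ (2 * k + 1) + (3 :: nat)"
    and "8 dvd 13 * 3 ^ (2 * k + 2) + (3 :: nat)"
proof -
  define t :: nat where "t = 3 ^ (2 * k)"
  have t: "t mod 8 = 1" by (simp add: t_def pow3_mod_8)
  have p: "3 ^ (2 * k + 1) = 3 * t" "3 ^ (2 * k + 2) = 9 * t" by (simp_all add: t_def)
  show "8 dvd 7 * 3 ^ (2 * k + 1) + (3 :: nat)" "8 dvd 5 * 3 ^ (2 * k + 2) + (3 :: nat)"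
    "8 dvd 23 * 3 ^ (2 * k + 1) + (3 :: nat)" "8 dvd 13 * 3 ^ (2 * k + 2) + (3 :: nat)"
    unfolding p using t by presburger+
qed

end

theory Submission
  imports Defs "HOL-Computational_Algebra.Formal_Power_Series"
    "HOL-Computational_Algebra.Polynomial" "HOL-Library.Product_Lexorder"
begin

text \<open>
  Let \<open>a\<close>, \<open>b\<close>, \<open>c\<close> be the cubic theta functions, \<open>E = (q; q)\<^sub>\<infinity>\<close>, \<open>x = a(q\<^sup>3)\<close> and
  \<open>y = c(q\<^sup>3)\<close>. The triple product gives \<open>\<Sum>n. cphi 9 n q\<^sup>n = \<theta> / E\<^sup>9\<close> with \<open>\<theta>\<close> the theta series of
  the lattice \<open>A\<^sub>8\<close>, which is an integral quartic form in \<open>x\<close> and \<open>y\<close>, and it also gives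
  \<open>E\<^sup>3 = E(q\<^sup>3) b\<close> with \<open>a = x + 2 y\<close>, \<open>b = x - y\<close> and \<open>x\<^sup>3 - y\<^sup>3 = b(q\<^sup>3)\<^sup>3\<close>. Since \<open>y\<close> is
  \<open>3 q\<close> times a series in \<open>q\<^sup>3\<close>, extracting the coefficients at \<open>3 n + r\<close> amounts to selecting
  the monomials \<open>x\<^sup>e y\<^sup>m\<close> with \<open>m \<equiv> r\<close> modulo 3, each of which carries a factor \<open>3\<^sup>m\<close>. With
  \<open>t = c\<^sup>3 / b\<^sup>3 = 27 q + \<dots>\<close>, iterated extraction therefore alternates between \<open>G \<cdot> \<int>[t]\<close> and
  \<open>G' \<cdot> \<int>[t]\<close> for two fixed series \<open>G\<close>, \<open>G'\<close>, and gains alternately the factors \<open>3\<^sup>4\<close> and \<open>3\<close>.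
  The resulting exponents \<open>5 k + 2\<close> and \<open>5 k + 3\<close> (with \<open>2\<close> more for the two skew residue
  classes) are at least the required ones as soon as \<open>k \<ge> 3\<close>.
\<close>

unbundle fps_syntax

section \<open>Trisection of power series\<close>

text \<open>Extraction closes up because of degrees. A series in q^3 passes through it, so
  everything is written as such a series times a form in x and y. Powers of 1/b fit this shape,
  since (x - y)(x^2 + x y + y^2) = b(q^3)^3, and so does t. In a form of degree 3 g + 1 + r the
  monomials kept at residue r have x-exponent 1 modulo 3; then a^3 = b^3 (1 + t) and c^3 = b^3 t
  turn each of them into one common factor times a polynomial in t. At the two skew residue classes
  the degree is in another class modulo 3, so they yield only divisibility and end the chain. The
  gain 3^4 needs more than y^2: it uses a factor 9 of t and, for the constant term in t, a
  divisibility in the coefficients of a (x^2 + x y + y^2)^4. The cube root of unity behind the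
  dissection of E^3 and the norm relation is not an integer; these identities are proved over the
  complex numbers and pulled back coefficientwise. The variable z of the triple product stays
  polynomial: finite products are multiplied by z^N and compared modulo q^M.\<close>

definition dil :: "'a::comm_ring_1 fps \<Rightarrow> 'a fps" where
  "dil f = fps_compose f (fps_X ^ 3)"

definition sec :: "nat \<Rightarrow> 'a fps \<Rightarrow> 'a fps" where
  "sec r f = Abs_fps (\<lambda>n. f $ (3 * n + r))"

lemma dil_nth: "dil f $ n = (if 3 dvd n then f $ (n div 3) else 0)"
proof -
  have "dil f $ n = (\<Sum>i = 0..n. if n = 3 * i then f $ i else 0)"
    unfolding dil_def fps_compose_nth power_mult [symmetric] fps_X_power_nth
    by (rule sum.cong) simp_all
  also have "\<dots> = (\<Sum>i \<in> {i \<in> {0..n}. n = 3 * i}. f $ i)"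
    by (rule sum.inter_filter [symmetric]) simp
  also have "\<dots> = (if 3 dvd n then f $ (n div 3) else 0)"
  proof (cases "3 dvd n")
    case True
    then have "{i \<in> {0..n}. n = 3 * i} = {n div 3}" by auto
    with True show ?thesis by simp
  next
    case False
    then have "{i \<in> {0..n}. n = 3 * i} = {}" by auto
    with False show ?thesis by (simp only: if_False sum.empty)
  qed
  finally show ?thesis .
qed

lemma dil_simps [simp]:
  fixes f g :: "'a::idom fps"
  shows "dil (f * g) = dil f * dil g" "dil (f + g) = dil f + dil g" "dil (f - g) = dil f - dil g"
    "dil (f ^ n) = dil f ^ n" "dil 0 = 0" "dil 1 = 1" "dil (numeral k) = numeral k"
    "dil fps_X = fps_X ^ 3"
  by (simp_all add: dil_def fps_compose_mult_distrib fps_compose_add_distrib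
      fps_compose_sub_distrib fps_compose_power)

lemma dil_inj: "dil f = dil g \<Longrightarrow> f = g"
proof (rule fps_ext)
  fix n assume "dil f = dil g"
  then have "dil f $ (3 * n) = dil g $ (3 * n)" by simp
  then show "f $ n = g $ n" by (simp add: dil_nth)
qed

lemma sec_nth [simp]: "sec r f $ n = f $ (3 * n + r)"
  by (simp add: sec_def)

lemma sec_simps [simp]:
  fixes f g :: "'a::comm_ring_1 fps"
  shows "sec r (f + g) = sec r f + sec r g" "sec r (of_int z * f) = of_int z * sec r f"
    "sec r (numeral k * f) = numeral k * sec r f" "sec r 0 = 0"
  by (simp_all add: fps_eq_iff numeral_fps_const flip: fps_of_int)

text \<open>Factors in q^3 do not move residue classes of exponents, so they pass through the
  extraction. This is why prefactors are later brought into the shape \<open>dil _\<close>.\<close>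

lemma sec_dil_mult:
  fixes f g :: "'a::idom fps"
  assumes "r < 3"
  shows "sec r (dil f * g) = f * sec r g"
proof (rule fps_ext)
  fix n
  have "sec r (dil f * g) $ n = (\<Sum>i = 0..3 * n + r. dil f $ i * g $ (3 * n + r - i))"
    by (simp add: fps_mult_nth)
  also have "\<dots> = (\<Sum>i \<in> (*) 3 ` {0..n}. dil f $ i * g $ (3 * n + r - i))"
  proof (rule sum.mono_neutral_right)
    show "\<forall>i\<in>{0..3 * n + r} - (*) 3 ` {0..n}. dil f $ i * g $ (3 * n + r - i) = 0"
    proof
      fix i assume i: "i \<in> {0..3 * n + r} - (*) 3 ` {0..n}"
      have "\<not> 3 dvd i"
      proof
        assume "3 dvd i"
        then obtain j where "i = 3 * j" ..
        with i \<open>r < 3\<close> show False by auto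
      qed
      then show "dil f $ i * g $ (3 * n + r - i) = 0" by (simp add: dil_nth)
    qed
  qed auto
  also have "\<dots> = (\<Sum>i = 0..n. f $ i * g $ (3 * n + r - 3 * i))"
    by (subst sum.reindex) (auto simp: dil_nth inj_on_def)
  also have "\<dots> = (f * sec r g) $ n"
    unfolding fps_mult_nth by (rule sum.cong) (auto simp: algebra_simps intro!: arg_cong [of _ _ "\<lambda>k. g $ k"])
  finally show "sec r (dil f * g) $ n = (f * sec r g) $ n" .
qed

lemma sec_dil_X_power:
  fixes f :: "'a::idom fps"
  assumes "r < 3"
  shows "sec r (fps_X ^ m * dil f) = (if m mod 3 = r then fps_X ^ (m div 3) * f else 0)"
proof -
  have X: "sec r (fps_X ^ m) = (if m mod 3 = r then fps_X ^ (m div 3) else (0 :: 'a fps))"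
  proof (rule fps_ext)
    fix n
    have "3 * n + r = m \<longleftrightarrow> m mod 3 = r \<and> n = m div 3" using assms by auto
    then show "sec r (fps_X ^ m) $ n = (if m mod 3 = r then fps_X ^ (m div 3) else (0 :: 'a fps)) $ n"
      by auto
  qed
  show ?thesis
    using sec_dil_mult [OF assms, of f "fps_X ^ m"] by (simp add: X mult.commute)
qed

text \<open>Passing to residue r adds 8 r times the current power of 3 to the numerator of the
  offset. Since 5 + 16 = 3 * 7 and 7 + 8 = 3 * 5, the two main progressions alternate; 7 + 16 = 23
  and 5 + 8 = 13 are the branches that leave them.\<close>

lemma index_shift:
  fixes k n :: nat
  shows "3 ^ (2 * k + 2) * (3 * n + 2) + (5 * 3 ^ (2 * k + 2) + 3) div 8
      = 3 ^ (2 * k + 3) * n + (7 * 3 ^ (2 * k + 3) + 3) div 8" (is ?A)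
    and "3 ^ (2 * k + 3) * (3 * n + 1) + (7 * 3 ^ (2 * k + 3) + 3) div 8
      = 3 ^ (2 * Suc k + 2) * n + (5 * 3 ^ (2 * Suc k + 2) + 3) div 8" (is ?B)
    and "3 ^ (2 * k + 3) * (3 * n + 2) + (7 * 3 ^ (2 * k + 3) + 3) div 8
      = 3 ^ (2 * k + 4) * n + (23 * 3 ^ (2 * k + 3) + 3) div 8" (is ?C)
    and "3 ^ (2 * k + 2) * (3 * n + 1) + (5 * 3 ^ (2 * k + 2) + 3) div 8
      = 3 ^ (2 * k + 3) * n + (13 * 3 ^ (2 * k + 2) + 3) div 8" (is ?D)
proof -
  define u v :: nat where "u = 3 ^ (2 * k + 2)" and "v = 3 ^ (2 * k + 3)"
  have uv: "3 ^ (2 * k + 3) = 3 * u" "3 ^ (2 * Suc k + 2) = 3 * v" "3 ^ (2 * k + 4) = 3 * v"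
    by (simp_all add: u_def v_def power_add)
  show ?A ?D
    unfolding uv(1) u_def [symmetric]
    using div_mult_self2 [of 8 "5 * u + 3" "2 * u"] div_mult_self2 [of 8 "5 * u + 3" u]
    by (simp_all add: algebra_simps)
  show ?B ?C
    unfolding uv(2,3) v_def [symmetric]
    using div_mult_self2 [of 8 "7 * v + 3" v] div_mult_self2 [of 8 "7 * v + 3" "2 * v"]
    by (simp_all add: algebra_simps)
qed

section \<open>The \<open>3\<close>-adic tower over the cubic theta functions\<close>

text \<open>In the notation of the Borweins \<open>a = a(q)\<close>, \<open>C = c(q) / (3 q\<^bsup>1/3\<^esup>)\<close> and
  \<open>b = b(q)\<close>; moreover \<open>E = (q; q)\<^sub>\<infinity>\<close>, and \<open>P\<close>, \<open>b'\<close> are the inverses of \<open>E\<close>, \<open>b\<close>.\<close>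

lemma cube_eq_dil_imp_one:
  fixes g :: "int fps"
  assumes "g ^ 3 = dil g" "g $ 0 = 1"
  shows "g = 1"
proof -
  have "g $ n = 0" if "0 < n" for n
    using that
  proof (induction n rule: less_induct)
    case (less n)
    have g: "g = 1 + fps_X ^ n * fps_shift n g"
      by (rule fps_ext) (use less assms(2) in \<open>auto simp: fps_X_power_mult_nth\<close>)
    \<comment> \<open>If the coefficients strictly between 0 and \<open>n\<close> vanish, cubing
      triples the one at \<open>n\<close>, whereas \<open>dil g\<close> at \<open>n\<close> only
      sees a smaller index, where \<open>g\<close> is already known to vanish.\<close>
    have "g ^ 3 = 1 + fps_X ^ n * (3 * fps_shift n g
        + fps_X ^ n * (3 * fps_shift n g ^ 2 + fps_X ^ n * fps_shift n g ^ 3))"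
      by (subst g) algebra
    then have "(g ^ 3) $ n = 3 * g $ n"
      using \<open>0 < n\<close> by (simp add: fps_X_power_mult_nth fps_numeral_nth fps_mult_nth_0)
    moreover have "dil g $ n = 0"
      using less by (auto simp: dil_nth)
    ultimately show ?case using assms(1) by simp
  qed
  with assms(2) show ?thesis by (intro fps_ext) (simp add: fps_one_nth)
qed

text \<open>The locale isolates the facts about theta functions on which the tower rests. The
  Borwein identity \<open>cubes\<close> and the product formula \<open>C_eq\<close> are derived from
  them instead of being assumed.\<close>

locale cubic_theta =
  fixes E P a C :: "int fps"
  assumes EP: "E * P = 1"
    and a_eq: "a = dil a + 2 * (3 * fps_X * dil C)"
    and b_eq: "E ^ 3 = dil E * (dil a - 3 * fps_X * dil C)"
    and norm_eq: "dil a ^ 3 - (3 * fps_X * dil C) ^ 3 = dil (E ^ 3 * dil P) ^ 3"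
    and E_0: "E $ 0 = 1"
    and C_0: "C $ 0 = 1"
begin

unbundle fps_syntax

definition "x = dil a"
definition "y = 3 * fps_X * dil C"
definition "s = x ^ 2 + x * y + y ^ 2"
definition "b = E ^ 3 * dil P"
definition "b' = P ^ 3 * dil E"
definition "t = 27 * fps_X * C ^ 3 * b' ^ 3"

lemma dil_EP: "dil E * dil P = 1"
  using arg_cong [OF EP, of dil] by simp

lemma bb': "b * b' = 1"
proof -
  have "b * b' = (E * P) ^ 3 * (dil E * dil P)" by (simp add: b_def b'_def algebra_simps)
  then show ?thesis by (simp add: EP dil_EP)
qed

lemma dil_bb': "dil b * dil b' = 1"
  using arg_cong [OF bb', of dil] by simp

lemma a_xy: "a = x + 2 * y" using a_eq by (simp add: x_def y_def)

lemma b_xy: "b = x - y"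
proof -
  have "b = (dil E * dil P) * (x - y)" by (simp add: b_def b_eq x_def y_def)
  then show ?thesis by (simp add: dil_EP)
qed

lemma norm_xy: "x ^ 3 - y ^ 3 = dil b ^ 3"
  using norm_eq by (simp add: x_def y_def b_def)

text \<open>This is \<open>norm_xy\<close> with q^3 replaced by q: all terms there are dilations,
  \<open>y ^ 3\<close> being that of \<open>27 * fps_X * C ^ 3\<close>.\<close>

lemma cubes: "a ^ 3 = b ^ 3 + 27 * fps_X * C ^ 3"
proof (rule dil_inj)
  show "dil (a ^ 3) = dil (b ^ 3 + 27 * fps_X * C ^ 3)"
    using norm_xy by (simp add: x_def y_def algebra_simps)
qed

lemma XC3: "27 * fps_X * C ^ 3 = b ^ 3 * t"
proof -
  have "b ^ 3 * t = 27 * fps_X * C ^ 3 * (b * b') ^ 3" by (simp add: t_def algebra_simps)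
  then show ?thesis by (simp add: bb')
qed

lemma a3: "a ^ 3 = b ^ 3 * (1 + t)"
  using cubes XC3 by (simp add: distrib_left)

text \<open>From \<open>b * s = x ^ 3 - y ^ 3 = dil b ^ 3\<close>. Thus every power of 1/b is a form
  in \<open>x\<close> and \<open>y\<close> times a series in q^3.\<close>

lemma b'_s: "b' = s * dil b' ^ 3"
proof -
  have "b * s = x ^ 3 - y ^ 3" using b_xy s_def by algebra
  then have "b * s = dil b ^ 3" by (simp add: norm_xy)
  then have "b * (s * dil b' ^ 3) = (dil b * dil b') ^ 3" by (simp add: algebra_simps)
  also have "\<dots> = 1" by (simp add: dil_bb')
  finally show ?thesis using bb' by algebra
qed

text \<open>The quotient \<open>g\<close> of the two sides is an integral series with constant term
  1 and \<open>g ^ 3 = dil g\<close>, hence equals 1. The cubic relation comes from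
  \<open>C ^ 3 = dil C * s\<close>, which is a^3 - b^3 = (x + 2 y)^3 - (x - y)^3 = 9 y s after
  division by 27 q.\<close>

lemma C_eq: "C * E = dil E ^ 3"
proof -
  have "27 * fps_X * C ^ 3 = 27 * fps_X * (dil C * s)"
  proof -
    have "27 * fps_X * C ^ 3 = 9 * y * s"
      using cubes a_xy b_xy s_def by algebra
    then show ?thesis by (simp add: y_def)
  qed
  then have "C ^ 3 = dil C * s" by simp
  also have "s = b' * dil b ^ 3"
  proof -
    have "b' * dil b ^ 3 = s * (dil b * dil b') ^ 3"
      by (subst b'_s) (simp add: power_mult_distrib)
    then show ?thesis by (simp add: dil_bb')
  qed
  finally have "(C * E * dil P ^ 3) ^ 3 = dil C * (b' * E ^ 3) * dil b ^ 3 * dil P ^ 9"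
    by (simp add: power_mult_distrib ac_simps flip: power_mult)
  also have "\<dots> = dil C * dil E * (E * P) ^ 3 * (dil E * dil P) ^ 9 * dil (dil P) ^ 3"
    by (simp add: b_def b'_def power_mult_distrib ac_simps flip: power_mult)
  also have "\<dots> = dil (C * E * dil P ^ 3)"
    by (simp add: EP dil_EP)
  finally have "(C * E * dil P ^ 3) ^ 3 = dil (C * E * dil P ^ 3)" .
  moreover have "P $ 0 = 1"
    using arg_cong [OF EP, of "\<lambda>f. f $ 0"] E_0 by (simp add: fps_mult_nth_0)
  then have "(C * E * dil P ^ 3) $ 0 = 1"
    by (simp add: fps_mult_nth_0 fps_nth_power_0 dil_nth C_0 E_0)
  ultimately have "C * E * dil P ^ 3 = 1"
    by (rule cube_eq_dil_imp_one)
  then have "(C * E * dil P ^ 3) * dil E ^ 3 = dil E ^ 3" by simp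
  moreover have "(C * E * dil P ^ 3) * dil E ^ 3 = C * E * (dil E * dil P) ^ 3"
    by (simp add: power_mult_distrib ac_simps)
  ultimately show ?thesis by (simp add: dil_EP)
qed

text \<open>Exhibits the factor 9 of \<open>t\<close> and writes it as a form of degree 9 times a
  series in q^3, so that multiplication by \<open>t\<close> does not change degrees modulo
  3.\<close>

lemma t_xy: "t = 9 * y * s ^ 4 * dil b' ^ 9"
proof -
  have "27 * fps_X * C ^ 3 = 9 * y * s"
    using cubes a_xy b_xy s_def by algebra
  then have "t = 9 * y * s * b' ^ 3" by (simp add: t_def)
  also have "\<dots> = 9 * y * s * (s * dil b' ^ 3) ^ 3" by (simp add: b'_s [symmetric])
  also have "\<dots> = 9 * y * s ^ 4 * dil b' ^ 9" by algebra
  finally show ?thesis .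
qed

section \<open>Integral forms in x and y, the ring of polynomials in t, and extraction on
  both\<close>

inductive form :: "nat \<Rightarrow> int fps \<Rightarrow> bool" where
  mono: "form (e + m) (of_int z * x ^ e * y ^ m)"
| add: "form n f \<Longrightarrow> form n g \<Longrightarrow> form n (f + g)"

lemma form_mono: "e + m = n \<Longrightarrow> form n (of_int z * x ^ e * y ^ m)"
  using mono by blast

lemma form_cong: "form m f \<Longrightarrow> m = n \<Longrightarrow> form n f"
  by simp

lemma form_scale: "form n f \<Longrightarrow> form n (of_int w * f)"
proof (induction rule: form.induct)
  case (mono e m z)
  have "of_int w * (of_int z * x ^ e * y ^ m) = of_int (w * z) * x ^ e * y ^ m"
    by (simp only: of_int_mult mult.assoc)
  then show ?case using form.mono [of e m "w * z"] by (simp only:)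
next
  case (add n f g)
  then show ?case by (simp add: distrib_left form.add)
qed

lemma form_mult: "form m f \<Longrightarrow> form n g \<Longrightarrow> form (m + n) (f * g)"
proof (induction rule: form.induct)
  case (mono e m z)
  from mono show ?case
  proof (induction rule: form.induct)
    case (mono e' m' z')
    have "of_int z * x ^ e * y ^ m * (of_int z' * x ^ e' * y ^ m')
        = of_int (z * z') * x ^ (e + e') * y ^ (m + m')"
      by (simp only: of_int_mult power_add ac_simps)
    then show ?case using form_mono [of "e + e'" "m + m'" _ "z * z'"] by (simp only: ac_simps)
  next
    case (add n f g)
    then show ?case by (simp add: distrib_left form.add)
  qed
next
  case (add k f g)
  then show ?case by (simp add: distrib_right form.add)
qed

lemma form_power: "form m f \<Longrightarrow> form (m * k) (f ^ k)"
  using form_mono [of 0 0 0 1] by (induction k) (auto dest: form_mult)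

lemma form_x: "form 1 x" and form_y: "form 1 y" and form_s: "form 2 s" and form_a: "form 1 a"
  and form_b: "form 1 b"
proof -
  show x: "form 1 x" using form_mono [of 1 0 1 1] by simp
  show y: "form 1 y" using form_mono [of 0 1 1 1] by simp
  show "form 2 s"
    using form_mono [of 2 0 2 1] form_mono [of 1 1 2 1] form_mono [of 0 2 2 1]
    unfolding s_def by (intro form.add) simp_all
  have "form 1 (x + 2 * y)" using form.add [OF x form_scale [OF y, of 2]] by simp
  then show "form 1 a" by (simp flip: a_xy)
  show "form 1 b" unfolding b_xy using form.add [OF x form_scale [OF y, of "-1"]] by simp
qed

inductive_set Zt :: "int fps set" where
  int: "of_int z \<in> Zt"
| t: "t \<in> Zt"
| add: "f \<in> Zt \<Longrightarrow> g \<in> Zt \<Longrightarrow> f + g \<in> Zt"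
| mult: "f \<in> Zt \<Longrightarrow> g \<in> Zt \<Longrightarrow> f * g \<in> Zt"

lemma Zt_simps [simp]: "0 \<in> Zt" "1 \<in> Zt" "numeral k \<in> Zt"
  using Zt.int [of 0] Zt.int [of 1] Zt.int [of "numeral k"] by simp_all

lemma Zt_power: "f \<in> Zt \<Longrightarrow> f ^ k \<in> Zt"
  by (induction k) (auto intro: Zt.mult)

text \<open>Separates the constant, which must find its powers of 3 in explicit coefficients, from
  the multiple of \<open>t\<close>, which gets a 9 from \<open>t_xy\<close>.\<close>

lemma Zt_split: "f \<in> Zt \<Longrightarrow> \<exists>z. \<exists>g\<in>Zt. f = of_int z + t * g"
proof (induction rule: Zt.induct)
  case (int z)
  show ?case by (intro exI [of _ z] bexI [of _ 0]) simp_all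
next
  case t
  show ?case by (intro exI [of _ 0] bexI [of _ 1]) simp_all
next
  case (add f f')
  then obtain z g z' g' where "g \<in> Zt" "g' \<in> Zt" "f = of_int z + t * g" "f' = of_int z' + t * g'"
    by blast
  then show ?case
    by (intro exI [of _ "z + z'"] bexI [of _ "g + g'"]) (auto intro: Zt.add simp: algebra_simps)
next
  case (mult f f')
  then obtain z g z' g' where g: "g \<in> Zt" "g' \<in> Zt" "f = of_int z + t * g" "f' = of_int z' + t * g'"
    by blast
  then have "f * f' = of_int (z * z') + t * (of_int z * g' + of_int z' * g + t * g * g')"
    by (simp add: algebra_simps)
  moreover have "of_int z * g' + of_int z' * g + t * g * g' \<in> Zt"
    using g by (intro Zt.intros)
  ultimately show ?case by blast
qed

lemma dil_b_form: "form 9 (dil b ^ 9)"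
proof -
  have "dil b ^ 9 = (dil b ^ 3) ^ 3" by (simp flip: power_mult)
  also have "\<dots> = (x ^ 3 + of_int (-1) * y ^ 3) ^ 3" by (simp flip: norm_xy)
  also have "form 9 \<dots>"
    using form_power [OF form.add [OF form_power [OF form_x, of 3]
        form_scale [OF form_power [OF form_y, of 3], of "-1"]], of 3] by simp
  finally show ?thesis .
qed

text \<open>Clears denominators: \<open>t\<close> is a form of degree 9 over
  \<open>dil b ^ 9\<close>. Sums need a common denominator, and this stays within forms because
  \<open>dil b ^ 9 = (x ^ 3 - y ^ 3) ^ 3\<close> is itself a form of degree 9.\<close>

lemma Zt_form: "f \<in> Zt \<Longrightarrow> \<exists>j h. form (9 * j) h \<and> f = h * dil b' ^ (9 * j)"
proof (induction rule: Zt.induct)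
  case (int z)
  show ?case using form_mono [of 0 0 0 z] by (intro exI [of _ 0] exI [of _ "of_int z"]) simp
next
  case t
  have "form 9 (of_int 9 * (y * s ^ 4))"
    using form_scale [OF form_mult [OF form_y form_power [OF form_s, of 4]], of 9] by simp
  then show ?case by (intro exI [of _ 1] exI [of _ "of_int 9 * (y * s ^ 4)"]) (simp add: t_xy mult.assoc)
next
  case (add f g)
  then obtain i h j k where
    hk: "form (9 * i) h" "form (9 * j) k" "f = h * dil b' ^ (9 * i)" "g = k * dil b' ^ (9 * j)"
    by blast
  have one: "(dil b ^ 9) ^ n * dil b' ^ (9 * n) = 1" for n
    by (simp add: dil_bb' flip: power_mult power_mult_distrib)
  have "(h * (dil b ^ 9) ^ j + k * (dil b ^ 9) ^ i) * dil b' ^ (9 * (i + j))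
    = h * dil b' ^ (9 * i) * ((dil b ^ 9) ^ j * dil b' ^ (9 * j))
      + k * dil b' ^ (9 * j) * ((dil b ^ 9) ^ i * dil b' ^ (9 * i))"
    by (simp add: distrib_left distrib_right power_add ac_simps)
  then have "f + g = (h * (dil b ^ 9) ^ j + k * (dil b ^ 9) ^ i) * dil b' ^ (9 * (i + j))"
    by (simp add: one hk(3,4))
  moreover have "form (9 * (i + j)) (h * (dil b ^ 9) ^ j + k * (dil b ^ 9) ^ i)"
    using form_mult [OF hk(1) form_power [OF dil_b_form, of j]]
      form_mult [OF hk(2) form_power [OF dil_b_form, of i]]
    by (intro form.add) (simp_all add: algebra_simps)
  ultimately show ?case by blast
next
  case (mult f g)
  then obtain i h j k where
    hk: "form (9 * i) h" "form (9 * j) k" "f = h * dil b' ^ (9 * i)" "g = k * dil b' ^ (9 * j)"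
    by blast
  then have "f * g = (h * k) * dil b' ^ (9 * (i + j))"
    by (simp add: distrib_left power_add ac_simps)
  with form_mult [OF hk(1,2)] show ?case by (metis distrib_left)
qed

lemma sec_mono:
  assumes "r < 3"
  shows "sec r (of_int z * x ^ e * y ^ m)
    = (if m mod 3 = r then of_int z * 3 ^ m * fps_X ^ (m div 3) * a ^ e * C ^ m else 0)"
proof -
  have "of_int z * x ^ e * y ^ m = of_int (z * 3 ^ m) * (fps_X ^ m * dil (a ^ e * C ^ m))"
    by (simp add: x_def y_def power_mult_distrib ac_simps)
  then have "sec r (of_int z * x ^ e * y ^ m)
      = of_int (z * 3 ^ m) * sec r (fps_X ^ m * dil (a ^ e * C ^ m))"
    by (simp only: sec_simps)
  also have "\<dots> = (if m mod 3 = r then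
      of_int z * 3 ^ m * fps_X ^ (m div 3) * a ^ e * C ^ m else 0)"
    unfolding sec_dil_X_power [OF assms] by (simp add: mult.assoc)
  finally show ?thesis .
qed

lemma sec_form_dvd: "form n f \<Longrightarrow> r < 3 \<Longrightarrow> 3 ^ r dvd sec r f"
proof (induction rule: form.induct)
  case (mono e m z)
  have "(3 :: int fps) ^ r dvd 3 ^ m" if "m mod 3 = r"
    using that by (intro le_imp_power_dvd) auto
  then show ?case by (auto simp: sec_mono mono)
qed simp

text \<open>For m = 3 i + r the degree forces e = 3 l + 1 with i + l = g. The monomial then becomes
  3^r a C^r (27 q C^3)^i (a^3)^l, and by \<open>XC3\<close> and \<open>a3\<close> the last two
  factors are b^(3 g) t^i (1 + t)^l. The powers of \<open>b\<close> agree for all monomials, which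
  is what makes the shape uniform.\<close>

lemma sec_form:
  "form n f \<Longrightarrow> n = 3 * g + 1 + r \<Longrightarrow> r < 3 \<Longrightarrow>
    \<exists>h\<in>Zt. sec r f = 3 ^ r * a * C ^ r * b ^ (3 * g) * h"
proof (induction rule: form.induct)
  case (mono e m z)
  show ?case
  proof (cases "m mod 3 = r")
    case False
    then show ?thesis using mono by (intro bexI [of _ 0]) (auto simp: sec_mono)
  next
    case True
    define i where "i = m div 3"
    define l where "l = g - i"
    have m: "m = 3 * i + r" using True mult_div_mod_eq [of 3 m] by (simp add: i_def)
    with mono have e: "e = 3 * l + 1" and g: "g = i + l" by (auto simp: l_def)
    have "sec r (of_int z * x ^ e * y ^ m)
        = of_int z * 3 ^ m * fps_X ^ i * a ^ e * C ^ m"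
      using mono True by (simp add: sec_mono i_def)
    also have "\<dots> = of_int z * (3 ^ r * 27 ^ i) * fps_X ^ i * (a * (a ^ 3) ^ l) * (C ^ r * (C ^ 3) ^ i)"
      by (simp add: m e power_add power_mult)
    also have "\<dots> = of_int z * 3 ^ r * a * C ^ r * (27 * fps_X * C ^ 3) ^ i * (a ^ 3) ^ l"
      by (simp only: power_mult_distrib ac_simps)
    also have "\<dots> = 3 ^ r * a * C ^ r * ((b ^ 3) ^ i * (b ^ 3) ^ l) * (of_int z * t ^ i * (1 + t) ^ l)"
      unfolding XC3 a3 by (simp only: power_mult_distrib ac_simps)
    also have "\<dots> = 3 ^ r * a * C ^ r * b ^ (3 * g) * (of_int z * t ^ i * (1 + t) ^ l)"
      by (simp add: g power_add power_mult)
    finally show ?thesis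
      by (rule bexI) (intro Zt.intros Zt_power Zt_simps)
  qed
next
  case (add n f f')
  then obtain h h' where "h \<in> Zt" "h' \<in> Zt"
    "sec r f = 3 ^ r * a * C ^ r * b ^ (3 * g) * h" "sec r f' = 3 ^ r * a * C ^ r * b ^ (3 * g) * h'"
    by blast
  then show ?case by (intro bexI [of _ "h + h'"]) (auto intro: Zt.add simp: algebra_simps)
qed

text \<open>The pair is forced: \<open>G\<close> is what residues 0 and 2 leave of a quartic form
  over E^9, \<open>G'\<close> is what residue 2 leaves of \<open>G\<close>, and residue 1 leads from
  \<open>G'\<close> back to \<open>G\<close>.\<close>

definition "G = a * C ^ 2 * b' ^ 3 * P"
definition "G' = a * E ^ 5 * C ^ 2 * b' ^ 6"

lemma P3: "P ^ 3 = b' * dil P"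
proof -
  have "b' * dil P = P ^ 3 * (dil E * dil P)" by (simp add: b'_def mult.assoc)
  then show ?thesis by (simp add: dil_EP)
qed

lemma C_P: "C = dil E ^ 3 * P"
proof -
  have "C * (E * P) = dil E ^ 3 * P" by (simp flip: C_eq mult.assoc)
  then show ?thesis by (simp add: EP)
qed

text \<open>By \<open>C_P\<close> the powers of \<open>P\<close> combine to
  \<open>P ^ 3 = b' * dil P\<close>, and the remaining \<open>b' ^ 4\<close> is \<open>s ^ 4\<close>
  up to a series in q^3. Extraction from \<open>G\<close> thus acts on a form of degree 9
  only.\<close>

lemma G_xy: "G = dil (E ^ 5 * b' ^ 12) * (a * s ^ 4)"
proof -
  have "G = a * dil E ^ 6 * (P ^ 3) * b' ^ 3"
    unfolding G_def by (subst C_P) (simp add: power_mult_distrib power_numeral_reduce ac_simps)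
  also have "\<dots> = a * dil E ^ 5 * (dil E * dil P) * b' ^ 4"
    unfolding P3 by (simp add: power_numeral_reduce ac_simps)
  also have "\<dots> = a * dil E ^ 5 * (s * dil b' ^ 3) ^ 4"
    by (simp add: dil_EP flip: b'_s)
  finally show ?thesis by (simp add: power_mult_distrib ac_simps flip: power_mult)
qed

lemma G'_xy: "G' = dil (E ^ 7 * b' ^ 15) * (a * s ^ 5)"
proof -
  have "G' = a * dil E ^ 6 * (E * P) ^ 2 * E ^ 3 * b' ^ 6"
    unfolding G'_def by (subst C_P) (simp add: power_mult_distrib power_numeral_reduce ac_simps)
  also have "\<dots> = a * dil E ^ 7 * (b * b') * b' ^ 5"
    by (simp add: EP b_eq b_xy flip: x_def y_def) (simp add: power_numeral_reduce ac_simps)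
  also have "\<dots> = a * dil E ^ 7 * (s * dil b' ^ 3) ^ 5"
    by (simp add: bb' flip: b'_s)
  finally show ?thesis by (simp add: power_mult_distrib ac_simps flip: power_mult)
qed

lemma bb'_power: "b ^ n * b' ^ (n + m) = b' ^ m"
  by (simp add: power_add bb' flip: mult.assoc power_mult_distrib)

lemma E8: "E ^ 8 = C * b ^ 3"
proof -
  have "b ^ 3 * C = E ^ 8 * (E * P) * (dil E * dil P) ^ 3"
    by (simp add: b_def C_P power_mult_distrib power_numeral_reduce ac_simps)
  then show ?thesis by (simp add: EP dil_EP mult.commute)
qed

text \<open>Closes the loop: the left side is what residue 1 leaves of \<open>G'\<close>, apart from
  \<open>a\<close> and a factor 3, and the right side is \<open>G\<close> without
  \<open>a\<close>.\<close>

lemma E7: "E ^ 7 * C * b' ^ 6 = C ^ 2 * b' ^ 3 * P"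
proof -
  have "E ^ 7 * C * b' ^ 6 = E ^ 8 * C * b' ^ 6 * P"
    using arg_cong [OF EP, of "\<lambda>u. E ^ 7 * C * b' ^ 6 * u"]
    by (simp add: power_numeral_reduce ac_simps)
  also have "\<dots> = C ^ 2 * (b ^ 3 * b' ^ (3 + 3)) * P"
    by (simp add: E8 power2_eq_square ac_simps)
  finally show ?thesis by (simp only: bb'_power)
qed

text \<open>For the part divisible by \<open>t\<close>, 81 is the 9 of \<open>t\<close> times the
  3^2 of a y-exponent congruent to 2. For the constant part, the first 9 has to come from the
  coefficients of \<open>a * s ^ 4\<close> instead. At residue 1 the degree does not fit
  \<open>sec_form\<close>, so only divisibility is claimed: the 9 of \<open>t\<close> suffices for
  one part, a 3 in the coefficients and a 3 from y for the other.\<close>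

lemma sec_G:
  assumes "f \<in> Zt"
  shows "\<exists>g\<in>Zt. sec 2 (G * f) = 81 * G' * g" and "9 dvd sec 1 (G * f)"
proof -
  obtain z g where g: "g \<in> Zt" "f = of_int z + t * g" using Zt_split [OF assms] by blast
  obtain j h where h: "form (9 * j) h" "g = h * dil b' ^ (9 * j)" using Zt_form [OF g(1)] by blast
  define k where "k = (a * s ^ 4) * (y * s ^ 4) * h"
  have k: "form (3 * (3 * j + 5) + 1 + 2) k"
    unfolding k_def
    by (rule form_cong [OF form_mult [OF form_mult [OF form_mult [OF form_a form_power [OF form_s, of 4]]
        form_mult [OF form_y form_power [OF form_s, of 4]]] h(1)]]) simp
  have eq: "G * f = dil (E ^ 5 * b' ^ 12) * (of_int z * (a * s ^ 4)) +
      dil (E ^ 5 * b' ^ (21 + 9 * j)) * (9 * k)"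
    by (simp add: G_xy g(2) h(2) t_xy k_def algebra_simps power_add power_numeral_reduce)
  have sec: "sec r (G * f) = E ^ 5 * b' ^ 12 * (of_int z * sec r (a * s ^ 4)) +
      E ^ 5 * b' ^ (21 + 9 * j) * (9 * sec r k)" if "r < 3" for r
    unfolding eq by (simp only: sec_simps sec_dil_mult [OF that])
  \<comment> \<open>the terms of \<open>a * s ^ 4\<close> by the exponent of \<open>y\<close> modulo 3: the extra factor \<open>9\<close> common to
    the coefficients at exponents \<open>2\<close> is what makes this step gain \<open>3 ^ 4\<close> instead of \<open>3 ^ 2\<close>\<close>
  define k1 where "k1 = of_int 17 * x ^ 5 * y ^ 4 + of_int 2 * x ^ 8 * y ^ 1 + of_int 8 * x ^ 2 * y ^ 7"
  define k2 where "k2 = of_int 2 * x ^ 7 * y ^ 2 + of_int 6 * x ^ 4 * y ^ 5 + of_int 1 * x ^ 1 * y ^ 8"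
  define k0 where "k0 = of_int 1 * x ^ 9 * y ^ 0 + of_int 36 * x ^ 6 * y ^ 3 + of_int 42 * x ^ 3 * y ^ 6 +
      of_int 2 * x ^ 0 * y ^ 9"
  have expand: "a * s ^ 4 = k0 + of_int 3 * k1 + of_int 9 * k2"
  proof -
    have "a * s ^ 4 = (x + 2 * y) * (x ^ 2 + x * y + y ^ 2) ^ 4"
      using a_xy s_def by simp
    also have "\<dots> = k0 + of_int 3 * k1 + of_int 9 * k2"
      unfolding k0_def k1_def k2_def by simp algebra
    finally show ?thesis .
  qed
  have "sec 2 k0 = 0" "sec 2 k1 = 0" "sec 1 k0 = 0" "sec 1 k2 = 0"
    by (simp_all only: k0_def k1_def k2_def sec_simps sec_mono) simp_all
  then have sec_expand: "sec 2 (a * s ^ 4) = 9 * sec 2 k2" "sec 1 (a * s ^ 4) = 3 * sec 1 k1"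
    unfolding expand sec_simps by simp_all
  have "form (3 * 2 + 1 + 2) k2"
    unfolding k2_def by (intro form.add form_mono) simp_all
  from sec_form [OF this refl] obtain q where q: "q \<in> Zt" "sec 2 k2 = 3 ^ 2 * a * C ^ 2 * b ^ (3 * 2) * q"
    by auto
  from sec_form [OF k refl] obtain p where p: "p \<in> Zt"
    "sec 2 k = 3 ^ 2 * a * C ^ 2 * b ^ (3 * (3 * j + 5)) * p"
    by auto
  have "sec 2 (G * f) = 81 * (a * E ^ 5 * C ^ 2) * (b ^ 6 * b' ^ (6 + 6) * (of_int z * q)
      + b ^ (15 + 9 * j) * b' ^ ((15 + 9 * j) + 6) * p)"
    by (subst sec, simp, subst p(2), subst sec_expand, subst q(2)) (simp add: algebra_simps)
  also have "\<dots> = 81 * G' * (of_int z * q + p)"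
    unfolding bb'_power by (simp add: G'_def algebra_simps)
  finally show "\<exists>g\<in>Zt. sec 2 (G * f) = 81 * G' * g"
    using p(1) q(1) by (blast intro: Zt.intros)
  have "form 9 k1"
    unfolding k1_def by (intro form.add form_mono) simp_all
  from sec_form_dvd [OF this, of 1] have "3 dvd sec 1 k1" by simp
  then have "9 dvd sec 1 (a * s ^ 4)"
    unfolding sec_expand using mult_dvd_mono [of 3 3 3 "sec 1 k1"] by simp
  then show "9 dvd sec 1 (G * f)"
    by (simp add: sec)
qed

text \<open>Here the form has degree 11 + 9 j, which fits \<open>sec_form\<close> at residue 1 and
  yields the 3 of a single y. At residue 2 it does not fit, and 3^2 from the y-exponents is all that
  is kept.\<close>

lemma sec_G':
  assumes "f \<in> Zt"
  shows "\<exists>g\<in>Zt. sec 1 (G' * f) = 3 * G * g" and "9 dvd sec 2 (G' * f)"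
proof -
  obtain j h where h: "form (9 * j) h" "f = h * dil b' ^ (9 * j)" using Zt_form [OF assms] by blast
  define k where "k = (a * s ^ 5) * h"
  have k: "form (3 * (3 * j + 3) + 1 + 1) k"
    unfolding k_def
    by (rule form_cong [OF form_mult [OF form_mult [OF form_a form_power [OF form_s, of 5]] h(1)]]) simp
  have eq: "G' * f = dil (E ^ 7 * b' ^ (15 + 9 * j)) * k"
    by (simp add: G'_xy h(2) k_def power_add ac_simps)
  have sec: "sec r (G' * f) = E ^ 7 * b' ^ (15 + 9 * j) * sec r k" if "r < 3" for r
    unfolding eq by (simp only: sec_dil_mult [OF that])
  from sec_form [OF k refl] obtain p where p: "p \<in> Zt"
    "sec 1 k = 3 ^ 1 * a * C ^ 1 * b ^ (3 * (3 * j + 3)) * p"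
    by auto
  have "sec 1 (G' * f) = 3 * a * (E ^ 7 * C) * (b ^ (9 + 9 * j) * b' ^ ((9 + 9 * j) + 6)) * p"
    by (subst sec, simp, subst p(2)) (simp add: algebra_simps)
  also have "\<dots> = 3 * a * (E ^ 7 * C * b' ^ 6) * p"
    unfolding bb'_power by (simp add: ac_simps)
  also have "\<dots> = 3 * G * p"
    unfolding E7 by (simp add: G_def ac_simps)
  finally show "\<exists>g\<in>Zt. sec 1 (G' * f) = 3 * G * g" using p(1) by blast
  from sec_form_dvd [OF k, of 2] show "9 dvd sec 2 (G' * f)"
    by (simp add: sec)
qed

text \<open>Up to a series in q^3, \<open>P ^ 9\<close> is \<open>s ^ 3\<close>, so residue 0 acts
  on a form of degree 10 and leaves \<open>a * P ^ 3\<close> times a polynomial in \<open>t\<close>.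
  The second extraction treats the constant and the multiple of \<open>t\<close> separately, as for
  \<open>G\<close>.\<close>

lemma sec_form4:
  assumes "form 4 f"
  shows "\<exists>g\<in>Zt. sec 2 (sec 0 (f * P ^ 9)) = 27 * G * g"
proof -
  have Pb: "P ^ 3 = dil (b' ^ 3 * P) * s"
    unfolding P3 by (subst b'_s) (simp add: ac_simps)
  have "f * P ^ 9 = f * (P ^ 3) ^ 3" by (simp flip: power_mult)
  also have "\<dots> = dil ((b' ^ 3 * P) ^ 3) * (f * s ^ 3)"
    unfolding Pb by (simp add: power_mult_distrib ac_simps)
  finally have "sec 0 (f * P ^ 9) = (b' ^ 3 * P) ^ 3 * sec 0 (f * s ^ 3)"
    by (simp only: sec_dil_mult)
  moreover have "form (3 * 3 + 1 + 0) (f * s ^ 3)"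
    using form_mult [OF assms form_power [OF form_s, of 3]] by simp
  from sec_form [OF this refl] obtain q where q: "q \<in> Zt" "sec 0 (f * s ^ 3) = a * b ^ 9 * q"
    by auto
  ultimately have "sec 0 (f * P ^ 9) = a * P ^ 3 * (b ^ 9 * b' ^ (9 + 0)) * q"
    by (simp add: power_mult_distrib ac_simps flip: power_mult)
  then have "sec 0 (f * P ^ 9) = a * P ^ 3 * q"
    unfolding bb'_power by simp
  also obtain z g where g: "g \<in> Zt" "q = of_int z + t * g" using Zt_split [OF q(1)] by blast
  obtain j h where h: "form (9 * j) h" "g = h * dil b' ^ (9 * j)" using Zt_form [OF g(1)] by blast
  define k where "k = (a * s) * (y * s ^ 4) * h"
  have k: "form (3 * (3 * j + 3) + 1 + 2) k"
    unfolding k_def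
    by (rule form_cong [OF form_mult [OF form_mult [OF form_mult [OF form_a form_s]
        form_mult [OF form_y form_power [OF form_s, of 4]]] h(1)]]) simp
  have "a * P ^ 3 * q = dil (b' ^ 3 * P) * (of_int z * (a * s)) + dil (b' ^ (12 + 9 * j) * P) * (9 * k)"
    unfolding Pb by (simp add: g(2) h(2) t_xy k_def algebra_simps power_add power_numeral_reduce)
  finally have sec: "sec 2 (sec 0 (f * P ^ 9)) =
      b' ^ 3 * P * (of_int z * sec 2 (a * s)) + b' ^ (12 + 9 * j) * P * (9 * sec 2 k)"
    by (simp only: sec_simps sec_dil_mult)
  have "a * s = of_int 1 * x ^ 3 * y ^ 0 + of_int 3 * x ^ 2 * y ^ 1 + of_int 3 * x ^ 1 * y ^ 2
      + of_int 2 * x ^ 0 * y ^ 3"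
  proof -
    have "a * s = (x + 2 * y) * (x ^ 2 + x * y + y ^ 2)"
      using a_xy s_def by simp
    also have "\<dots> = of_int 1 * x ^ 3 * y ^ 0 + of_int 3 * x ^ 2 * y ^ 1 + of_int 3 * x ^ 1 * y ^ 2
      + of_int 2 * x ^ 0 * y ^ 3"
      by simp algebra
    finally show ?thesis .
  qed
  \<comment> \<open>Only the monomial 3 x y^2 has y-exponent congruent to 2; its coefficient 3 and
    the 3^2 of y^2 make 27.\<close>
  then have as: "sec 2 (a * s) = 27 * a * C ^ 2"
    by (simp only: sec_simps sec_mono) (simp add: mult.assoc)
  from sec_form [OF k refl] obtain p where p: "p \<in> Zt"
    "sec 2 k = 3 ^ 2 * a * C ^ 2 * b ^ (3 * (3 * j + 3)) * p"
    by auto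
  have "sec 2 (sec 0 (f * P ^ 9)) = 27 * (a * C ^ 2 * P) * (of_int z * b' ^ 3 +
      3 * (b ^ (9 + 9 * j) * b' ^ ((9 + 9 * j) + 3) * p))"
    by (simp add: sec as p(2) algebra_simps)
  also have "\<dots> = 27 * G * (of_int z + 3 * p)"
    unfolding bb'_power by (simp add: G_def algebra_simps)
  finally show ?thesis
    using p(1) by (blast intro: Zt.intros Zt_simps)
qed

section \<open>Climbing the tower\<close>

lemma tower:
  fixes \<phi> :: "nat \<Rightarrow> int"
  assumes "form 4 f" "Abs_fps \<phi> = f * P ^ 9"
  shows tower_even: "\<exists>g\<in>Zt. Abs_fps (\<lambda>n. \<phi> (3 ^ (2 * k + 2) * n + (5 * 3 ^ (2 * k + 2) + 3) div 8)) = 3 ^ (5 * k + 3) * G * g"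
      (is "\<exists>g\<in>Zt. ?even k = _ k * G * g")
    and tower_odd: "\<exists>g\<in>Zt. Abs_fps (\<lambda>n. \<phi> (3 ^ (2 * k + 3) * n + (7 * 3 ^ (2 * k + 3) + 3) div 8)) = 3 ^ (5 * k + 7) * G' * g"
      (is "\<exists>g\<in>Zt. ?odd k = _ k * G' * g")
proof -
  have odd: "\<exists>g\<in>Zt. ?odd k = 3 ^ (5 * k + 7) * G' * g"
    if even: "\<exists>g\<in>Zt. ?even k = 3 ^ (5 * k + 3) * G * g" for k
  proof -
    from even obtain g where g: "g \<in> Zt" "?even k = of_int (3 ^ (5 * k + 3)) * (G * g)"
      by (auto simp: mult.assoc)
    obtain h where h: "h \<in> Zt" "sec 2 (G * g) = 81 * G' * h" using sec_G(1) [OF g(1)] by blast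
    have "?odd k = sec 2 (?even k)"
      by (rule fps_ext) (simp only: sec_nth fps_nth_Abs_fps index_shift)
    also have "\<dots> = 3 ^ (5 * k + 7) * G' * h"
      unfolding g(2) sec_simps h(2) by (simp add: power_add)
    finally show ?thesis using h(1) by blast
  qed
  have even: "\<exists>g\<in>Zt. ?even k = 3 ^ (5 * k + 3) * G * g" for k
  proof (induction k)
    case 0
    \<comment> \<open>The lowest progression is 9 n + 6 = 3 (3 n + 2): residue 0, then residue
      2.\<close>
    have "?even 0 = sec 2 (sec 0 (Abs_fps \<phi>))"
      by (rule fps_ext) (simp add: algebra_simps)
    with sec_form4 [OF assms(1)] show ?case by (simp add: assms(2))
  next
    case (Suc k)
    from odd [OF Suc] obtain g where g: "g \<in> Zt" "?odd k = of_int (3 ^ (5 * k + 7)) * (G' * g)"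
      by (auto simp: mult.assoc)
    obtain h where h: "h \<in> Zt" "sec 1 (G' * g) = 3 * G * h" using sec_G'(1) [OF g(1)] by blast
    have "?even (Suc k) = sec 1 (?odd k)"
      by (rule fps_ext) (simp only: sec_nth fps_nth_Abs_fps index_shift)
    also have "\<dots> = 3 ^ (5 * Suc k + 3) * G * h"
      unfolding g(2) sec_simps h(2) by (simp add: power_add)
    finally show ?case using h(1) by blast
  qed
  from even show "\<exists>g\<in>Zt. ?even k = 3 ^ (5 * k + 3) * G * g" .
  from odd [OF even] show "\<exists>g\<in>Zt. ?odd k = 3 ^ (5 * k + 7) * G' * g" .
qed

lemma dvd_coeff:
  fixes f h :: "int fps"
  assumes "h = 3 ^ m * f"
  shows "3 ^ m dvd h $ n"
proof -
  have "3 ^ m * f = fps_const (3 ^ m) * f" by (simp add: numeral_fps_const fps_const_power)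
  with assms show ?thesis by simp
qed

lemma tower_dvd:
  fixes \<phi> :: "nat \<Rightarrow> int"
  assumes "form 4 f" "Abs_fps \<phi> = f * P ^ 9"
  shows "3 ^ (5 * k + 7) dvd \<phi> (3 ^ (2 * k + 3) * n + (7 * 3 ^ (2 * k + 3) + 3) div 8)"
    and "3 ^ (5 * k + 3) dvd \<phi> (3 ^ (2 * k + 2) * n + (5 * 3 ^ (2 * k + 2) + 3) div 8)"
    and "3 ^ (5 * k + 9) dvd \<phi> (3 ^ (2 * k + 4) * n + (23 * 3 ^ (2 * k + 3) + 3) div 8)"
    and "3 ^ (5 * k + 5) dvd \<phi> (3 ^ (2 * k + 3) * n + (13 * 3 ^ (2 * k + 2) + 3) div 8)"
proof -
  define e where "e = Abs_fps (\<lambda>n. \<phi> (3 ^ (2 * k + 2) * n + (5 * 3 ^ (2 * k + 2) + 3) div 8))"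
  define o' where "o' = Abs_fps (\<lambda>n. \<phi> (3 ^ (2 * k + 3) * n + (7 * 3 ^ (2 * k + 3) + 3) div 8))"
  obtain g where g: "g \<in> Zt" "e = 3 ^ (5 * k + 3) * (G * g)"
    using tower_even [OF assms, of k] by (auto simp: e_def mult.assoc)
  obtain h where h: "h \<in> Zt" "o' = 3 ^ (5 * k + 7) * (G' * h)"
    using tower_odd [OF assms, of k] by (auto simp: o'_def mult.assoc)
  from dvd_coeff [OF h(2), of n]
  show "3 ^ (5 * k + 7) dvd \<phi> (3 ^ (2 * k + 3) * n + (7 * 3 ^ (2 * k + 3) + 3) div 8)"
    by (simp add: o'_def)
  from dvd_coeff [OF g(2), of n]
  show "3 ^ (5 * k + 3) dvd \<phi> (3 ^ (2 * k + 2) * n + (5 * 3 ^ (2 * k + 2) + 3) div 8)"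
    by (simp add: e_def)
  obtain f2 where f2: "sec 2 (G' * h) = 9 * f2" using sec_G'(2) [OF h(1)] by (elim dvdE)
  have "sec 2 o' = of_int (3 ^ (5 * k + 7)) * sec 2 (G' * h)"
    unfolding sec_simps [symmetric] by (simp add: h(2))
  then have "sec 2 o' = 3 ^ (5 * k + 9) * f2" by (simp add: f2 power_add)
  from dvd_coeff [OF this, of n]
  show "3 ^ (5 * k + 9) dvd \<phi> (3 ^ (2 * k + 4) * n + (23 * 3 ^ (2 * k + 3) + 3) div 8)"
    by (simp only: o'_def sec_nth fps_nth_Abs_fps index_shift)
  obtain f1 where f1: "sec 1 (G * g) = 9 * f1" using sec_G(2) [OF g(1)] by (elim dvdE)
  have "sec 1 e = of_int (3 ^ (5 * k + 3)) * sec 1 (G * g)"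
    unfolding sec_simps [symmetric] by (simp add: g(2))
  then have "sec 1 e = 3 ^ (5 * k + 5) * f1" unfolding f1 by (simp add: power_add)
  from dvd_coeff [OF this, of n]
  show "3 ^ (5 * k + 5) dvd \<phi> (3 ^ (2 * k + 3) * n + (13 * 3 ^ (2 * k + 2) + 3) div 8)"
    by (simp only: e_def sec_nth fps_nth_Abs_fps index_shift)
qed

end

section \<open>Theta series of lattices\<close>

text \<open>Weights are integers so that quadratic polynomials can be used freely. An infinite level
  set would count as 0, whence the condition \<open>graded\<close> in the rules for unions and
  products.\<close>

definition gf :: "'s set \<Rightarrow> ('s \<Rightarrow> int) \<Rightarrow> 'r::comm_ring_1 fps" where
  "gf S w = Abs_fps (\<lambda>n. of_nat (card {s \<in> S. w s = int n}))"

definition graded :: "'s set \<Rightarrow> ('s \<Rightarrow> int) \<Rightarrow> bool" where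
  "graded S w \<longleftrightarrow> (\<forall>s\<in>S. 0 \<le> w s) \<and> (\<forall>n. finite {s \<in> S. w s = n})"

lemma gf_nth: "gf S w $ n = of_nat (card {s \<in> S. w s = int n})"
  by (simp add: gf_def)

lemma bij_betw_filter: "bij_betw f S T \<Longrightarrow> bij_betw f {s \<in> S. Q (f s)} {t \<in> T. Q t}"
  unfolding bij_betw_def inj_on_def by blast

lemma gf_bij:
  assumes "bij_betw f S S'" and "\<And>s. s \<in> S \<Longrightarrow> w' (f s) = w s"
  shows "(gf S w :: 'r::comm_ring_1 fps) = gf S' w'"
proof (rule fps_ext)
  fix n
  have "{s \<in> S. w s = int n} = {s \<in> S. w' (f s) = int n}" using assms(2) by auto
  then have "bij_betw f {s \<in> S. w s = int n} {s \<in> S'. w' s = int n}"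
    by (simp only:) (rule bij_betw_filter [OF assms(1)])
  then show "gf S w $ n = (gf S' w' $ n :: 'r)"
    by (simp add: gf_nth bij_betw_same_card)
qed

lemma gf_cong: "(\<And>s. s \<in> S \<Longrightarrow> w s = w' s) \<Longrightarrow> gf S w = gf S w'"
  by (rule gf_bij [of id]) auto

lemma gf_shift:
  assumes "\<And>s. s \<in> S \<Longrightarrow> 0 \<le> w s"
  shows "(gf S (\<lambda>s. w s + int k) :: 'r::comm_ring_1 fps) = fps_X ^ k * gf S w"
proof (rule fps_ext)
  fix n
  show "gf S (\<lambda>s. w s + int k) $ n = (fps_X ^ k * gf S w :: 'r fps) $ n"
  proof (cases "n < k")
    case True
    with assms have "{s \<in> S. w s + int k = int n} = {}" by force
    with True show ?thesis by (simp add: gf_nth fps_X_power_mult_nth del: Collect_empty_eq)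
  next
    case False
    then have "{s \<in> S. w s + int k = int n} = {s \<in> S. w s = int (n - k)}" by auto
    with False show ?thesis by (simp add: gf_nth fps_X_power_mult_nth)
  qed
qed

lemma gf_dil: "(gf S (\<lambda>s. 3 * w s) :: 'r::comm_ring_1 fps) = dil (gf S w)"
proof (rule fps_ext)
  fix n
  show "gf S (\<lambda>s. 3 * w s) $ n = (dil (gf S w) :: 'r fps) $ n"
  proof (cases "3 dvd n")
    case True
    then have "{s \<in> S. 3 * w s = int n} = {s \<in> S. w s = int (n div 3)}" by auto
    with True show ?thesis by (simp add: gf_nth dil_nth)
  next
    case False
    have "{s \<in> S. 3 * w s = int n} = {}"
    proof -
      have "int n \<noteq> 3 * w s" for s using False by presburger
      then show ?thesis by (metis (mono_tags, lifting) empty_Collect_eq)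
    qed
    with False show ?thesis by (simp only: gf_nth dil_nth if_False card.empty of_nat_0)
  qed
qed

lemma gf_UN:
  assumes "finite I" and "graded (\<Union>i\<in>I. S i) w"
    and "\<And>i j. i \<in> I \<Longrightarrow> j \<in> I \<Longrightarrow> i \<noteq> j \<Longrightarrow> S i \<inter> S j = {}"
  shows "(gf (\<Union>i\<in>I. S i) w :: 'r::comm_ring_1 fps) = (\<Sum>i\<in>I. gf (S i) w)"
proof (rule fps_ext)
  fix n
  have eq: "{s \<in> (\<Union>i\<in>I. S i). w s = int n} = (\<Union>i\<in>I. {s \<in> S i. w s = int n})" by auto
  have "finite {s \<in> S i. w s = int n}" if "i \<in> I" for i
    by (rule finite_subset [of _ "{s \<in> (\<Union>i\<in>I. S i). w s = int n}"])
      (use that assms(2) in \<open>auto simp: graded_def\<close>)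
  then have "card {s \<in> (\<Union>i\<in>I. S i). w s = int n} = (\<Sum>i\<in>I. card {s \<in> S i. w s = int n})"
    unfolding eq using assms(1,3) by (intro card_UN_disjoint) blast+
  then show "gf (\<Union>i\<in>I. S i) w $ n = (\<Sum>i\<in>I. gf (S i) w :: 'r fps) $ n"
    by (simp add: gf_nth fps_sum_nth)
qed

lemma graded_Times:
  assumes "graded S v" "graded T w"
  shows "graded (S \<times> T) (\<lambda>(s, t). v s + w t)"
  unfolding graded_def
proof (intro conjI allI)
  show "\<forall>p\<in>S \<times> T. 0 \<le> (case p of (s, t) \<Rightarrow> v s + w t)"
    using assms by (auto simp: graded_def)
  fix n
  have "{p \<in> S \<times> T. (case p of (s, t) \<Rightarrow> v s + w t) = n}
      \<subseteq> (\<Union>i\<in>{0..n}. {s \<in> S. v s = i} \<times> {t \<in> T. w t = n - i})"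
    using assms by (force simp: graded_def)
  moreover have "finite \<dots>"
    using assms by (intro finite_UN_I finite_cartesian_product) (auto simp: graded_def)
  ultimately show "finite {p \<in> S \<times> T. (case p of (s, t) \<Rightarrow> v s + w t) = n}"
    by (rule finite_subset)
qed

lemma gf_Times:
  assumes "graded S v" "graded T w"
  shows "(gf (S \<times> T) (\<lambda>(s, t). v s + w t) :: 'r::comm_ring_1 fps) = gf S v * gf T w"
proof (rule fps_ext)
  fix n
  have eq: "{p \<in> S \<times> T. (case p of (s, t) \<Rightarrow> v s + w t) = int n}
      = (\<Union>i\<in>{0..n}. {s \<in> S. v s = int i} \<times> {t \<in> T. w t = int (n - i)})" (is "?L = ?R")
  proof (intro equalityI subsetI)
    fix p assume "p \<in> ?L"
    then obtain s t where p: "p = (s, t)" "s \<in> S" "t \<in> T" "v s + w t = int n" by auto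
    then have "0 \<le> v s" "0 \<le> w t" using assms by (auto simp: graded_def)
    with p show "p \<in> ?R" by (auto intro!: bexI [of _ "nat (v s)"])
  qed auto
  have "card ?L = (\<Sum>i\<in>{0..n}. card ({s \<in> S. v s = int i} \<times> {t \<in> T. w t = int (n - i)}))"
    unfolding eq using assms by (intro card_UN_disjoint) (auto simp: graded_def)
  then show "gf (S \<times> T) (\<lambda>(s, t). v s + w t) $ n = (gf S v * gf T w :: 'r fps) $ n"
    by (simp add: gf_nth fps_mult_nth card_cartesian_product)
qed

section \<open>Triangular weights and the cubic theta functions\<close>

definition tr :: "int \<Rightarrow> int" where "tr m = m * (m + 1) div 2"

lemma two_tr: "2 * tr m = m * (m + 1)"
  by (simp add: tr_def)

lemma tr_bounds: "0 \<le> tr m" "m \<le> tr m" "- m - 1 \<le> tr m"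
proof -
  have "0 \<le> m * (m + 1)" by (cases "m \<ge> 0") (auto simp: zero_le_mult_iff)
  then show "0 \<le> tr m" using two_tr [of m] by linarith
  have "0 \<le> m * (m - 1)" by (cases "m \<ge> 1") (auto simp: zero_le_mult_iff)
  then show "m \<le> tr m" using two_tr [of m] by (simp add: algebra_simps)
  have "0 \<le> (m + 1) * (m + 2)" by (cases "m \<ge> - 1") (auto simp: zero_le_mult_iff)
  then show "- m - 1 \<le> tr m" using two_tr [of m] by (simp add: algebra_simps)
qed

text \<open>On triples with sum 0 this is half the squared norm, so these triples form the hexagonal
  lattice A_2. Sums -1 and -2 give its two nontrivial cosets, shifted to start at weight 0.\<close>

definition w3 :: "int \<times> int \<times> int \<Rightarrow> int" where
  "w3 = (\<lambda>(x, y, z). tr x + tr y + tr z)"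

definition tri :: "int \<Rightarrow> (int \<times> int \<times> int) set" where
  "tri s = {(x, y, z). x + y + z = s}"

definition tri_mod :: "int \<Rightarrow> int \<Rightarrow> (int \<times> int \<times> int) set" where
  "tri_mod s r = {(x, y, z). x + y + z = s \<and> (x - y) mod 3 = r}"

lemma graded_w3: "graded S w3"
  unfolding graded_def
proof (intro conjI allI ballI)
  show "0 \<le> w3 p" for p
    by (cases p) (simp add: w3_def tr_bounds)
  fix n
  have "{p \<in> S. w3 p = n} \<subseteq> {- n - 1..n} \<times> {- n - 1..n} \<times> {- n - 1..n}"
  proof
    fix p assume "p \<in> {p \<in> S. w3 p = n}"
    then obtain x y z where p: "p = (x, y, z)" "n = tr x + tr y + tr z"
      by (cases p) (simp add: w3_def)
    have "0 \<le> tr m \<and> m \<le> tr m \<and> - m - 1 \<le> tr m" for m using tr_bounds by simp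
    from this [of x] this [of y] this [of z]
    show "p \<in> {- n - 1..n} \<times> {- n - 1..n} \<times> {- n - 1..n}"
      by (simp add: p)
  qed
  then show "finite {p \<in> S. w3 p = n}" by (rule finite_subset) simp
qed

lemma w3_nonneg: "0 \<le> w3 p"
  using graded_w3 [of UNIV] unfolding graded_def by blast

lemma tri_UN_tri_mod: "tri s = (\<Union>r\<in>{0, 1, 2}. tri_mod s r)"
proof (intro equalityI subsetI)
  fix p assume "p \<in> tri s"
  then obtain x y z where "p = (x, y, z)" "x + y + z = s" by (auto simp: tri_def)
  moreover have "(x - y) mod 3 = 0 \<or> (x - y) mod 3 = 1 \<or> (x - y) mod 3 = 2" by presburger
  ultimately show "p \<in> (\<Union>r\<in>{0, 1, 2}. tri_mod s r)" by (auto simp: tri_mod_def)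
qed (auto simp: tri_def tri_mod_def)

lemma gf_tri_mod: "(gf (tri s) w3 :: 'r::comm_ring_1 fps) = gf (tri_mod s 0) w3 + gf (tri_mod s 1) w3 + gf (tri_mod s 2) w3"
proof -
  have "(gf (\<Union>r\<in>{0, 1, 2}. tri_mod s r) w3 :: 'r fps) = (\<Sum>r\<in>{0, 1, 2}. gf (tri_mod s r) w3)"
    by (rule gf_UN) (auto simp: graded_w3 tri_mod_def)
  then show ?thesis by (simp add: add.assoc tri_UN_tri_mod)
qed

abbreviation cubic_a :: "'a::comm_ring_1 fps" where "cubic_a \<equiv> gf (tri 0) w3"
text \<open>One third of the coset of sum -1, obtained without dividing by 3: cyclic rotation of the
  coordinates permutes the three classes of x - y modulo 3.\<close>

definition cubic_c :: "'a::comm_ring_1 fps" where "cubic_c = gf (tri_mod (- 1) 0) w3"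

lemma gf_tri_neg1_mod:
  "gf (tri_mod (- 1) 1) w3 = (cubic_c :: 'r::comm_ring_1 fps)"
  "gf (tri_mod (- 1) 2) w3 = (cubic_c :: 'r fps)"
proof -
  have *: "gf (tri_mod (- 1) r) w3 = (gf (tri_mod (- 1) ((r + 1) mod 3)) w3 :: 'r fps)" if "r \<in> {0, 1, 2}" for r
  proof (rule gf_bij)
    show "bij_betw (\<lambda>(x, y, z). (y, z, x)) (tri_mod (- 1) r) (tri_mod (- 1) ((r + 1) mod 3))"
    proof (rule bij_betwI [where g = "\<lambda>(x, y, z). (z, x, y)"], goal_cases)
      case 1
      show ?case unfolding tri_mod_def using that by auto presburger+
    next
      case 2
      show ?case unfolding tri_mod_def using that by auto presburger+
    qed auto
  qed (auto simp: w3_def)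
  have "gf (tri_mod (- 1) 0) w3 = (gf (tri_mod (- 1) 1) w3 :: 'r fps)" using * [of 0] by simp
  then show 1: "gf (tri_mod (- 1) 1) w3 = (cubic_c :: 'r fps)" unfolding cubic_c_def by (rule sym)
  from * [of 1] show "gf (tri_mod (- 1) 2) w3 = (cubic_c :: 'r fps)" by (simp add: 1)
qed

lemma gf_tri_neg1: "gf (tri (- 1)) w3 = 3 * cubic_c"
  by (simp add: gf_tri_mod gf_tri_neg1_mod flip: cubic_c_def)

lemma gf_tri_neg2: "(gf (tri (- 2)) w3 :: 'r::comm_ring_1 fps) = 3 * cubic_c"
proof -
  have "(gf (tri (- 2)) w3 :: 'r fps)  = gf (tri (- 1)) w3"
  proof (rule gf_bij)
    show "bij_betw (\<lambda>(x, y, z). (- 1 - x, - 1 - y, - 1 - z)) (tri (- 2)) (tri (- 1))"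
      by (rule bij_betwI [where g = "\<lambda>(x, y, z). (- 1 - x, - 1 - y, - 1 - z)"])
        (auto simp: tri_def)
    have "tr (- 1 - m) = tr m" for m
      using two_tr [of m] two_tr [of "- 1 - m"] by (simp add: algebra_simps)
    then show "w3 ((\<lambda>(x, y, z). (- 1 - x, - 1 - y, - 1 - z)) p) = w3 p" for p
      by (cases p) (simp add: w3_def)
  qed
  then show ?thesis by (simp add: gf_tri_neg1)
qed

text \<open>On differences of coordinates \<open>\<Sum>(k\<^sub>i - k\<^sub>j)\<^sup>2 = 3 \<Sum>k\<^sub>i\<^sup>2 - (\<Sum>k\<^sub>i)\<^sup>2\<close>: this rotation
  of the hexagonal lattice identifies it with a sublattice of index 3.\<close>

lemma gf_tri_0_mod_0: "(gf (tri_mod 0 0) w3 :: 'r::comm_ring_1 fps) = dil cubic_a"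
proof -
  have "(gf (tri 0) (\<lambda>p. 3 * w3 p) :: 'r fps)  = gf (tri_mod 0 0) w3"
  proof (rule gf_bij)
    show "bij_betw (\<lambda>(x, y, z). (x - y, y - z, z - x)) (tri 0) (tri_mod 0 0)"
    proof (rule bij_betwI [where g = "\<lambda>(x, y, z). (x + (y - x) div 3, (y - x) div 3, (y - x) div 3 - y)"],
        goal_cases)
      case 1
      show ?case unfolding tri_mod_def tri_def by auto presburger
    next
      case 2
      show ?case unfolding tri_mod_def tri_def by auto presburger
    next
      case (3 p)
      then show ?case unfolding tri_def by auto
    next
      case (4 p)
      then show ?case unfolding tri_mod_def by auto
    qed
    fix p assume "p \<in> tri 0"
    then obtain x y z where "p = (x, y, z)" "x + y + z = 0" by (auto simp: tri_def)
    moreover from this have "z = - x - y" by simp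
    ultimately have p: "p = (x, y, - x - y)" by simp
    show "w3 (case p of (x, y, z) \<Rightarrow> (x - y, y - z, z - x)) = 3 * w3 p"
      using two_tr [of x] two_tr [of y] two_tr [of "- x - y"] two_tr [of "x - y"]
        two_tr [of "y - (- x - y)"] two_tr [of "- x - y - x"]
      by (simp add: p w3_def algebra_simps)
  qed
  then show ?thesis by (simp add: gf_dil)
qed

text \<open>The same rotation on the coset of sum -1: the first two differences now differ by -1 - 3
  y, which is in class 2, and completing the square leaves the extra weight 1.\<close>

lemma gf_tri_0_mod_2: "(gf (tri_mod 0 2) w3 :: 'r::comm_ring_1 fps) = fps_X * dil (3 * cubic_c)"
proof -
  have "(gf (tri (- 1)) (\<lambda>p. 3 * w3 p + int 1) :: 'r fps)  = gf (tri_mod 0 2) w3"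
  proof (rule gf_bij)
    show "bij_betw (\<lambda>(x, y, z). (x - y, y - z, z - x)) (tri (- 1)) (tri_mod 0 2)"
    proof (rule bij_betwI [where g = "\<lambda>(x, y, z). (x + (y - x - 1) div 3, (y - x - 1) div 3, (y - x - 1) div 3 - y)"],
        goal_cases)
      case 1
      show ?case unfolding tri_mod_def tri_def by auto presburger
    next
      case 2
      show ?case unfolding tri_mod_def tri_def by auto presburger
    next
      case (3 p)
      then show ?case unfolding tri_def by auto
    next
      case (4 p)
      then show ?case unfolding tri_mod_def by auto
    qed
    fix p assume "p \<in> tri (- 1)"
    then obtain x y z where "p = (x, y, z)" "x + y + z = - 1" by (auto simp: tri_def)
    moreover from this have "z = - 1 - x - y" by simp
    ultimately have p: "p = (x, y, - 1 - x - y)" by simp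
    show "w3 (case p of (x, y, z) \<Rightarrow> (x - y, y - z, z - x)) = 3 * w3 p + int 1"
      using two_tr [of x] two_tr [of y] two_tr [of "- 1 - x - y"] two_tr [of "x - y"]
        two_tr [of "y - (- 1 - x - y)"] two_tr [of "- 1 - x - y - x"]
      by (simp add: p w3_def algebra_simps)
  qed
  moreover have "(gf (tri (- 1)) (\<lambda>p. 3 * w3 p + int 1) :: 'r fps)  = fps_X ^ 1 * gf (tri (- 1)) (\<lambda>p. 3 * w3 p)"
    by (rule gf_shift) (simp add: w3_nonneg)
  ultimately show ?thesis by (simp add: gf_dil gf_tri_neg1 del: dil_simps)
qed

lemma gf_tri_0_mod_1: "(gf (tri_mod 0 1) w3 :: 'r::comm_ring_1 fps) = fps_X * dil (3 * cubic_c)"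
proof -
  have "(gf (tri_mod 0 1) w3 :: 'r fps)  = gf (tri_mod 0 2) w3"
  proof (rule gf_bij)
    show "bij_betw (\<lambda>(x, y, z). (y, x, z)) (tri_mod 0 1) (tri_mod 0 2)"
    proof (rule bij_betwI [where g = "\<lambda>(x, y, z). (y, x, z)"], goal_cases)
      case 1
      show ?case unfolding tri_mod_def by auto presburger
    next
      case 2
      show ?case unfolding tri_mod_def by auto presburger
    qed auto
  qed (auto simp: w3_def)
  then show ?thesis by (simp add: gf_tri_0_mod_2)
qed

section \<open>The lattice A_8 cut into three triples\<close>

definition nonary :: "((int \<times> int \<times> int) \<times> (int \<times> int \<times> int) \<times> (int \<times> int \<times> int)) set" where
  "nonary = {((a, b, c), (d, e, f), (g, h, i)). a + b + c + (d + e + f) + (g + h + i) = 0}"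

definition w9 :: "(int \<times> int \<times> int) \<times> (int \<times> int \<times> int) \<times> (int \<times> int \<times> int) \<Rightarrow> int" where
  "w9 = (\<lambda>(p, q, r). w3 p + (w3 q + w3 r))"

lemma graded_w9: "graded S w9"
proof -
  have w9: "w9 = (\<lambda>(p, q). w3 p + (case q of (q, r) \<Rightarrow> w3 q + w3 r))"
    by (auto simp: w9_def)
  have "graded (UNIV \<times> (UNIV \<times> UNIV)) w9"
    unfolding w9 by (intro graded_Times graded_w3)
  then show ?thesis unfolding graded_def by (auto elim!: finite_subset [rotated])
qed

text \<open>The cost of translation: by tr (m + k) = tr m + tr k + m k, moving a triple of sum -r by
  k along (1, 1, 1) adds 3 tr k - r k to its weight.\<close>

definition shift_w :: "int \<times> int \<times> int \<Rightarrow> int \<times> int \<times> int \<Rightarrow> int" where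
  "shift_w = (\<lambda>(r1, r2, r3) (k1, k2, k3). 3 * w3 (k1, k2, k3) - (r1 * k1 + r2 * k2 + r3 * k3))"

definition shift_gf :: "int \<times> int \<times> int \<Rightarrow> 'r::comm_ring_1 fps" where
  "shift_gf = (\<lambda>(r1, r2, r3). gf (tri ((r1 + r2 + r3) div 3)) (shift_w (r1, r2, r3)))"

lemma tr_scaled: "0 \<le> r \<Longrightarrow> r \<le> 2 \<Longrightarrow> tr k \<le> 3 * tr k - r * k"
proof -
  assume r: "0 \<le> r" "r \<le> 2"
  have "r * k \<le> 2 * tr k"
  proof (cases "k \<ge> 1")
    case True
    then have "r * k \<le> 2 * k" "2 * k \<le> k * (k + 1)" using r by (auto intro: mult_right_mono mult_left_mono)
    then show ?thesis unfolding two_tr by linarith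
  next
    case False
    then have "r * k \<le> 0" using r by (simp add: mult_le_0_iff)
    then show ?thesis using tr_bounds(1) [of k] by linarith
  qed
  then show ?thesis by simp
qed

lemma graded_shift_w:
  assumes "r \<in> {0..2} \<times> {0..2} \<times> {0..2}"
  shows "graded S (shift_w r)"
proof -
  have le: "w3 k \<le> shift_w r k" for k
  proof -
    obtain r1 r2 r3 k1 k2 k3 where "r = (r1, r2, r3)" "k = (k1, k2, k3)" by (metis prod_cases3)
    then show ?thesis
      using assms tr_scaled [of r1 k1] tr_scaled [of r2 k2] tr_scaled [of r3 k3]
      by (simp add: w3_def shift_w_def)
  qed
  show ?thesis
    unfolding graded_def
  proof (intro conjI allI ballI)
    show "0 \<le> shift_w r k" for k
      using le [of k] w3_nonneg [of k] by linarith
    fix n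
    have "{k \<in> S. shift_w r k = n} \<subseteq> (\<Union>i\<in>{0..n}. {k \<in> S. w3 k = i})"
      using le w3_nonneg by auto
    moreover have "finite \<dots>"
      using graded_w3 [of S] by (auto simp: graded_def)
    ultimately show "finite {k \<in> S. shift_w r k = n}" by (rule finite_subset)
  qed
qed

definition nonary_mod :: "int \<times> int \<times> int \<Rightarrow>
    ((int \<times> int \<times> int) \<times> (int \<times> int \<times> int) \<times> (int \<times> int \<times> int)) set" where
  "nonary_mod = (\<lambda>(r1, r2, r3). {((a, b, c), (d, e, f), (g, h, i)).
     a + b + c + (d + e + f) + (g + h + i) = 0 \<and>
     (a + b + c + r1) mod 3 = 0 \<and> (d + e + f + r2) mod 3 = 0 \<and> (g + h + i + r3) mod 3 = 0})"

text \<open>Moving each triple of coordinates along \<open>(1, 1, 1)\<close> brings its sum into \<open>{0, - 1, - 2}\<close>.\<close>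

lemma gf_nonary_mod:
  assumes "r1 \<in> {0..2}" "r2 \<in> {0..2}" "r3 \<in> {0..2}" "3 dvd r1 + r2 + r3"
  shows "(gf (nonary_mod (r1, r2, r3)) w9 :: 'r::comm_ring_1 fps) =
    gf (tri (- r1)) w3 * (gf (tri (- r2)) w3 * (gf (tri (- r3)) w3 * shift_gf (r1, r2, r3)))"
proof -
  obtain m where m: "r1 + r2 + r3 = 3 * m" using assms(4) ..
  let ?f = "\<lambda>((a, b, c), (d, e, f), (g, h, i), (k1, k2, k3)).
    ((a + k1, b + k1, c + k1), (d + k2, e + k2, f + k2), (g + k3, h + k3, i + k3)) ::
    (int \<times> int \<times> int) \<times> (int \<times> int \<times> int) \<times> (int \<times> int \<times> int)"
  let ?g = "\<lambda>((a, b, c), (d, e, f), (g, h, i)).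
    let k1 = (a + b + c + r1) div 3; k2 = (d + e + f + r2) div 3; k3 = (g + h + i + r3) div 3
    in ((a - k1, b - k1, c - k1), (d - k2, e - k2, f - k2), (g - k3, h - k3, i - k3), (k1, k2, k3))"
  have "gf (tri (- r1) \<times> tri (- r2) \<times> tri (- r3) \<times> tri ((r1 + r2 + r3) div 3))
      (\<lambda>(p, q). w3 p + (case q of (p, q) \<Rightarrow> w3 p + (case q of (p, q) \<Rightarrow> w3 p + shift_w (r1, r2, r3) q)))
    = (gf (nonary_mod (r1, r2, r3)) w9 :: 'r fps)"
  proof (rule gf_bij)
    show "bij_betw ?f (tri (- r1) \<times> tri (- r2) \<times> tri (- r3) \<times> tri ((r1 + r2 + r3) div 3))
        (nonary_mod (r1, r2, r3))"
    proof (rule bij_betwI [where g = ?g], goal_cases)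
      case 1
      show ?case
      proof
        fix p assume "p \<in> tri (- r1) \<times> tri (- r2) \<times> tri (- r3) \<times> tri ((r1 + r2 + r3) div 3)"
        then obtain a b c d e f g h i k1 k2 k3 where p: "p = ((a, b, c), (d, e, f), (g, h, i), (k1, k2, k3))"
          and sums: "a + b + c = - r1" "d + e + f = - r2" "g + h + i = - r3" "k1 + k2 + k3 = m"
          by (auto simp: tri_def m)
        have *: "a + k1 + (b + k1) + (c + k1) + r1 = 3 * k1" "d + k2 + (e + k2) + (f + k2) + r2 = 3 * k2"
          "g + k3 + (h + k3) + (i + k3) + r3 = 3 * k3"
          using sums by simp_all
        have "a + k1 + (b + k1) + (c + k1) + (d + k2 + (e + k2) + (f + k2)) + (g + k3 + (h + k3) + (i + k3)) = 0"
          using sums m by linarith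
        then show "?f p \<in> nonary_mod (r1, r2, r3)"
          unfolding p nonary_mod_def mem_Collect_eq prod.case * by simp
      qed
    next
      case 2
      show ?case
      proof
        fix p assume "p \<in> nonary_mod (r1, r2, r3)"
        then obtain a b c d e f g h i where p: "p = ((a, b, c), (d, e, f), (g, h, i))"
          and sum: "a + b + c + (d + e + f) + (g + h + i) = 0"
          and mods: "(a + b + c + r1) mod 3 = 0" "(d + e + f + r2) mod 3 = 0" "(g + h + i + r3) mod 3 = 0"
          by (auto simp: nonary_mod_def)
        define k1 k2 k3 where k: "k1 = (a + b + c + r1) div 3" "k2 = (d + e + f + r2) div 3"
          "k3 = (g + h + i + r3) div 3"
        have "3 * k1 = a + b + c + r1" "3 * k2 = d + e + f + r2" "3 * k3 = g + h + i + r3"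
          using mods by (auto simp: k)
        with sum m show "?g p \<in> tri (- r1) \<times> tri (- r2) \<times> tri (- r3) \<times> tri ((r1 + r2 + r3) div 3)"
          by (simp add: p tri_def Let_def flip: k)
      qed
    next
      case (3 p)
      then show ?case by (auto simp: tri_def Let_def)
    next
      case (4 p)
      then show ?case by (auto simp: Let_def split: prod.split)
    qed
    have tr: "tr (m + k) = tr m + tr k + m * k" for m k
      using two_tr [of "m + k"] two_tr [of m] two_tr [of k] by (simp add: algebra_simps)
    fix s assume "s \<in> tri (- r1) \<times> tri (- r2) \<times> tri (- r3) \<times> tri ((r1 + r2 + r3) div 3)"
    then obtain a b c d e f g h i k1 k2 k3 where s: "s = ((a, b, c), (d, e, f), (g, h, i), (k1, k2, k3))"
      and sums: "a + b + c = - r1" "d + e + f = - r2" "g + h + i = - r3"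
      by (auto simp: tri_def)
    have "(a + b + c) * k1 = - r1 * k1" "(d + e + f) * k2 = - r2 * k2" "(g + h + i) * k3 = - r3 * k3"
      by (simp_all only: sums)
    then show "w9 (?f s) = (case s of (p, q) \<Rightarrow> w3 p + (case q of (p, q) \<Rightarrow> w3 p +
        (case q of (p, q) \<Rightarrow> w3 p + shift_w (r1, r2, r3) q)))"
      by (simp add: s w9_def w3_def shift_w_def tr algebra_simps)
  qed
  moreover have "gf (tri (- r1) \<times> tri (- r2) \<times> tri (- r3) \<times> tri ((r1 + r2 + r3) div 3))
      (\<lambda>(p, q). w3 p + (case q of (p, q) \<Rightarrow> w3 p + (case q of (p, q) \<Rightarrow> w3 p + shift_w (r1, r2, r3) q)))
    = (gf (tri (- r1)) w3 * (gf (tri (- r2)) w3 * (gf (tri (- r3)) w3 * shift_gf (r1, r2, r3))) :: 'r fps)"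
    using assms by (simp add: gf_Times graded_Times graded_w3 graded_shift_w shift_gf_def)
  ultimately show ?thesis by simp
qed

lemma shift_gf_swap12: "(shift_gf (r2, r1, r3) :: 'r::comm_ring_1 fps) = shift_gf (r1, r2, r3)"
proof -
  have "(gf (tri ((r2 + r1 + r3) div 3)) (shift_w (r2, r1, r3)) :: 'r fps)
      = gf (tri ((r1 + r2 + r3) div 3)) (shift_w (r1, r2, r3))"
  proof (rule gf_bij)
    show "bij_betw (\<lambda>(x, y, z). (y, x, z)) (tri ((r2 + r1 + r3) div 3)) (tri ((r1 + r2 + r3) div 3))"
      by (rule bij_betwI [where g = "\<lambda>(x, y, z). (y, x, z)"]) (auto simp: tri_def add_ac)
  qed (auto simp: w3_def shift_w_def)
  then show ?thesis by (simp add: shift_gf_def)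
qed

lemma shift_gf_swap23: "(shift_gf (r1, r3, r2) :: 'r::comm_ring_1 fps) = shift_gf (r1, r2, r3)"
proof -
  have "(gf (tri ((r1 + r3 + r2) div 3)) (shift_w (r1, r3, r2)) :: 'r fps)
      = gf (tri ((r1 + r2 + r3) div 3)) (shift_w (r1, r2, r3))"
  proof (rule gf_bij)
    show "bij_betw (\<lambda>(x, y, z). (x, z, y)) (tri ((r1 + r3 + r2) div 3)) (tri ((r1 + r2 + r3) div 3))"
      by (rule bij_betwI [where g = "\<lambda>(x, y, z). (x, z, y)"]) (auto simp: tri_def add_ac)
  qed (auto simp: w3_def shift_w_def)
  then show ?thesis by (simp add: shift_gf_def)
qed

lemma shift_gf_000: "(shift_gf (0, 0, 0) :: 'r::comm_ring_1 fps) = dil cubic_a"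
proof -
  have "(gf (tri 0) (shift_w (0, 0, 0)) :: 'r fps)  = gf (tri 0) (\<lambda>p. 3 * w3 p)"
    by (rule gf_cong) (auto simp: shift_w_def)
  then show ?thesis by (simp add: shift_gf_def gf_dil)
qed

lemma gf_tri_neg1_scaled: "(gf (tri (- 1)) (\<lambda>p. 3 * w3 p + int k) :: 'r::comm_ring_1 fps) = fps_X ^ k * dil (3 * cubic_c)"
  using gf_shift [of "tri (- 1)" "\<lambda>p. 3 * w3 p" k]
  by (simp add: w3_nonneg gf_dil gf_tri_neg1 del: dil_simps)

lemma shift_gf_111: "(shift_gf (1, 1, 1) :: 'r::comm_ring_1 fps) = fps_X ^ 2 * dil (3 * cubic_c)"
proof -
  have "(gf (tri (- 1)) (\<lambda>p. 3 * w3 p + int 2) :: 'r fps)  = gf (tri 1) (shift_w (1, 1, 1))"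
  proof (rule gf_bij)
    show "bij_betw (\<lambda>(x, y, z). (- x, - y, - z)) (tri (- 1)) (tri 1)"
      by (rule bij_betwI [where g = "\<lambda>(x, y, z). (- x, - y, - z)"]) (auto simp: tri_def)
    fix p assume "p \<in> tri (- 1)"
    then obtain x y z where p: "p = (x, y, z)" "x + y + z = - 1" by (auto simp: tri_def)
    have "tr (- m) = tr m - m" for m
      using two_tr [of m] two_tr [of "- m"] by (simp add: algebra_simps)
    then show "shift_w (1, 1, 1) (case p of (x, y, z) \<Rightarrow> (- x, - y, - z)) = 3 * w3 p + int 2"
      using p(2) by (simp add: p(1) w3_def shift_w_def)
  qed
  then show ?thesis using gf_tri_neg1_scaled [of 2, where ?'r = 'r] by (simp add: shift_gf_def del: dil_simps)
qed

lemma shift_gf_222: "(shift_gf (2, 2, 2) :: 'r::comm_ring_1 fps) = fps_X ^ 2 * dil (3 * cubic_c)"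
proof -
  have "(gf (tri (- 1)) (\<lambda>p. 3 * w3 p + int 2) :: 'r fps)  = gf (tri 2) (shift_w (2, 2, 2))"
  proof (rule gf_bij)
    show "bij_betw (\<lambda>(x, y, z). (x + 1, y + 1, z + 1)) (tri (- 1)) (tri 2)"
      by (rule bij_betwI [where g = "\<lambda>(x, y, z). (x - 1, y - 1, z - 1)"]) (auto simp: tri_def)
    fix p assume "p \<in> tri (- 1)"
    then obtain x y z where p: "p = (x, y, z)" "x + y + z = - 1" by (auto simp: tri_def)
    have "tr (m + 1) = tr m + m + 1" for m
      using two_tr [of m] two_tr [of "m + 1"] by (simp add: algebra_simps)
    then show "shift_w (2, 2, 2) (case p of (x, y, z) \<Rightarrow> (x + 1, y + 1, z + 1)) = 3 * w3 p + int 2"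
      using p(2) by (simp add: p(1) w3_def shift_w_def)
  qed
  then show ?thesis using gf_tri_neg1_scaled [of 2, where ?'r = 'r] by (simp add: shift_gf_def del: dil_simps)
qed

text \<open>Unequal residues undo the dilation: completing the square shows that the weight is 1
  plus that of the integral vector (x - y, y - z, z - x - 1), which runs through one class of the
  coset of sum -1.\<close>

lemma shift_gf_012: "(shift_gf (0, 1, 2) :: 'r::comm_ring_1 fps) = fps_X * cubic_c"
proof -
  have "(gf (tri 1) (shift_w (0, 1, 2)) :: 'r fps)  = gf (tri_mod (- 1) 1) (\<lambda>p. w3 p + int 1)"
  proof (rule gf_bij)
    show "bij_betw (\<lambda>(x, y, z). (x - y, y - z, z - x - 1)) (tri 1) (tri_mod (- 1) 1)"
    proof (rule bij_betwI [where g = "\<lambda>(x, y, z). (x + (y - x + 1) div 3, (y - x + 1) div 3, (y - x + 1) div 3 - y)"],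
        goal_cases)
      case 1
      show ?case unfolding tri_mod_def tri_def by auto presburger
    next
      case 2
      show ?case unfolding tri_mod_def tri_def by auto presburger
    next
      case (3 p)
      then show ?case unfolding tri_def by auto
    next
      case (4 p)
      then show ?case unfolding tri_mod_def by auto
    qed
    fix p assume "p \<in> tri 1"
    then obtain x y z where "p = (x, y, z)" "x + y + z = 1" by (auto simp: tri_def)
    moreover from this have "z = 1 - x - y" by simp
    ultimately have p: "p = (x, y, 1 - x - y)" by simp
    show "w3 (case p of (x, y, z) \<Rightarrow> (x - y, y - z, z - x - 1)) + int 1 = shift_w (0, 1, 2) p"
      using two_tr [of x] two_tr [of y] two_tr [of "1 - x - y"] two_tr [of "x - y"]
        two_tr [of "y - (1 - x - y)"] two_tr [of "1 - x - y - x - 1"]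
      by (simp add: p w3_def shift_w_def algebra_simps)
  qed
  moreover have "(gf (tri_mod (- 1) 1) (\<lambda>p. w3 p + int 1) :: 'r fps)  = fps_X ^ 1 * gf (tri_mod (- 1) 1) w3"
    by (rule gf_shift) (simp add: w3_nonneg)
  ultimately show ?thesis by (simp add: shift_gf_def gf_tri_neg1_mod)
qed

text \<open>The three residues add up to 0 modulo 3, so they are all equal or all distinct. Residues
  111 and 222 give 2 * 3^3 * 3 = 162, the six orders of 012 give 6 * 3^2 = 54, and 000 gives the
  first term.\<close>

theorem gf_nonary:
  "gf nonary w9 = (cubic_a :: 'r::idom fps) ^ 3 * dil cubic_a + 54 * fps_X * cubic_a * cubic_c ^ 3
    + 162 * fps_X ^ 2 * cubic_c ^ 3 * dil cubic_c"
proof -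
  define R :: "(int \<times> int \<times> int) set" where
    "R = {(0, 0, 0), (1, 1, 1), (2, 2, 2), (0, 1, 2), (0, 2, 1), (1, 0, 2), (1, 2, 0), (2, 0, 1), (2, 1, 0)}"
  have R: "R \<subseteq> {0..2} \<times> {0..2} \<times> {0..2}" by (simp add: R_def)
  have "nonary = (\<Union>r\<in>R. nonary_mod r)"
  proof (intro equalityI subsetI)
    fix p assume "p \<in> nonary"
    then obtain a b c d e f g h i where p: "p = ((a, b, c), (d, e, f), (g, h, i))"
      and sum: "a + b + c + (d + e + f) + (g + h + i) = 0"
      by (auto simp: nonary_def)
    define r where "r = ((- (a + b + c)) mod 3, (- (d + e + f)) mod 3, (- (g + h + i)) mod 3)"
    have "p \<in> nonary_mod r"
      unfolding p r_def nonary_mod_def using sum by (auto simp: mod_simps)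
    moreover have "r \<in> R"
    proof -
      define s1 s2 s3 where "s1 = a + b + c" "s2 = d + e + f" "s3 = g + h + i"
      have "\<exists>q. (- s) mod 3 = - s - 3 * q" for s :: int
        using minus_mult_div_eq_mod [of "- s" 3] by metis
      then obtain q1 q2 q3 where q: "(- s1) mod 3 = - s1 - 3 * q1" "(- s2) mod 3 = - s2 - 3 * q2"
        "(- s3) mod 3 = - s3 - 3 * q3"
        by meson
      have "s1 + s2 + s3 = 0"
        using sum by (simp add: \<open>s1 = a + b + c\<close> \<open>s2 = d + e + f\<close> \<open>s3 = g + h + i\<close>)
      then have "- s1 - 3 * q1 + (- s2 - 3 * q2) + (- s3 - 3 * q3) = 3 * (- q1 - q2 - q3)"
        by (simp add: algebra_simps)
      then have "((- s1) mod 3 + (- s2) mod 3 + (- s3) mod 3) mod 3 = 0"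
        unfolding q by (simp only: mod_mult_self1_is_0)
      moreover have "(- s) mod 3 = 0 \<or> (- s) mod 3 = 1 \<or> (- s) mod 3 = 2" for s :: int
        by presburger
      from this [of s1] this [of s2] this [of s3] calculation
      show ?thesis
        unfolding r_def R_def \<open>s1 = a + b + c\<close> [symmetric] \<open>s2 = d + e + f\<close> [symmetric]
          \<open>s3 = g + h + i\<close> [symmetric]
        by (elim disjE) simp_all
    qed
    ultimately show "p \<in> (\<Union>r\<in>R. nonary_mod r)" by blast
  qed (auto simp: nonary_mod_def nonary_def)
  moreover have "nonary_mod r \<inter> nonary_mod r' = {}" if "r \<in> R" "r' \<in> R" "r \<noteq> r'" for r r'
  proof -
    obtain r1 r2 r3 r1' r2' r3' where r: "r = (r1, r2, r3)" "r' = (r1', r2', r3')"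
      by (metis prod_cases3)
    have "r1 \<in> {0..2}" "r2 \<in> {0..2}" "r3 \<in> {0..2}" "r1' \<in> {0..2}" "r2' \<in> {0..2}" "r3' \<in> {0..2}"
      using that(1,2) R unfolding r by blast+
    note range = this
    have unique: "x = y" if "x \<in> {0..2}" "y \<in> {0..2}" "(s + x) mod 3 = 0" "(s + y) mod 3 = 0" for x y s :: int
    proof -
      have "3 dvd (s + x) - (s + y)" using that(3,4) by (intro dvd_diff) presburger+
      then have "3 dvd x - y" by simp
      moreover have "x \<in> {0, 1, 2}" "y \<in> {0, 1, 2}" using that(1,2) by auto
      ultimately show ?thesis by auto
    qed
    show ?thesis
    proof (rule ccontr)
      assume "nonary_mod r \<inter> nonary_mod r' \<noteq> {}"
      then obtain p where p: "p \<in> nonary_mod (r1, r2, r3)" "p \<in> nonary_mod (r1', r2', r3')"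
        unfolding r by blast
      obtain a b c d e f g h i where "p = ((a, b, c), (d, e, f), (g, h, i))"
        by (metis prod_cases3)
      with p have
        "(a + b + c + r1) mod 3 = 0" "(d + e + f + r2) mod 3 = 0" "(g + h + i + r3) mod 3 = 0"
        "(a + b + c + r1') mod 3 = 0" "(d + e + f + r2') mod 3 = 0" "(g + h + i + r3') mod 3 = 0"
        unfolding nonary_mod_def by (simp_all only: mem_Collect_eq prod.case)
      then have "r1 = r1'" "r2 = r2'" "r3 = r3'"
        using range by (metis unique)+
      with that(3) show False by (simp add: r)
    qed
  qed
  ultimately have "gf nonary w9 = (\<Sum>r\<in>R. gf (nonary_mod r) w9 :: 'r fps)"
    using gf_UN [of R nonary_mod w9] by (simp add: graded_w9 R_def)
  also have "\<dots> = cubic_a ^ 3 * dil cubic_a + 2 * ((3 * cubic_c) ^ 3 * (fps_X ^ 2 * dil (3 * cubic_c)))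
      + 6 * (cubic_a * (3 * cubic_c) ^ 2 * (fps_X * cubic_c))"
  proof -
    have eqs: "shift_gf (0, 2, 1) = (fps_X * cubic_c :: 'r fps)" "shift_gf (1, 0, 2) = (fps_X * cubic_c :: 'r fps)"
      "shift_gf (2, 0, 1) = (fps_X * cubic_c :: 'r fps)" "shift_gf (1, 2, 0) = (fps_X * cubic_c :: 'r fps)"
      "shift_gf (2, 1, 0) = (fps_X * cubic_c :: 'r fps)"
      using shift_gf_swap23 [of 0 2 1, where ?'r = 'r] shift_gf_swap12 [of 1 0 2, where ?'r = 'r]
       shift_gf_swap12 [of 2 0 1, where ?'r = 'r] shift_gf_swap23 [of 1 2 0, where ?'r = 'r]
       shift_gf_swap23 [of 2 1 0, where ?'r = 'r] shift_gf_012 [where ?'r = 'r]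
      by simp_all
    show ?thesis
      by (simp add: R_def gf_nonary_mod gf_tri_neg1 gf_tri_neg2 shift_gf_000 shift_gf_111 shift_gf_222
          shift_gf_012 eqs del: dil_simps)
        (simp only: power2_eq_square power3_eq_cube, algebra)
  qed
  also have "\<dots> = cubic_a ^ 3 * dil cubic_a + 54 * fps_X * cubic_a * cubic_c ^ 3
    + 162 * fps_X ^ 2 * cubic_c ^ 3 * dil cubic_c"
    by simp algebra
  finally show ?thesis .
qed

section \<open>The Jacobi triple product\<close>

definition agree :: "nat \<Rightarrow> 'r::zero fps \<Rightarrow> 'r fps \<Rightarrow> bool" where
  "agree M f g \<longleftrightarrow> (\<forall>i<M. f $ i = g $ i)"

lemma agree_refl [simp]: "agree M f f"
  and agree_sym: "agree M f g \<Longrightarrow> agree M g f"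
  and agree_trans [trans]: "agree M f g \<Longrightarrow> agree M g h \<Longrightarrow> agree M f h"
  and agree_mono: "agree M f g \<Longrightarrow> m \<le> M \<Longrightarrow> agree m f g"
  by (auto simp: agree_def)

lemma agree_mult:
  "agree M f g \<Longrightarrow> agree M h k \<Longrightarrow> agree M (f * h) (g * k)" for f :: "'r::comm_ring_1 fps"
  by (auto simp: agree_def fps_mult_nth intro!: sum.cong)

lemma agree_sum: "(\<And>i. i \<in> A \<Longrightarrow> agree M (f i) (g i)) \<Longrightarrow> agree M (sum f A) (sum g A)"
  for f :: "'i \<Rightarrow> 'r::comm_ring_1 fps"
  by (auto simp: agree_def fps_sum_nth intro!: sum.cong)

lemma agree_X_power: "M \<le> n \<Longrightarrow> agree M (fps_X ^ n * f) 0" for f :: "'r::comm_ring_1 fps"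
  by (auto simp: agree_def fps_X_power_mult_nth)

lemma agree_dil: "agree M f g \<Longrightarrow> agree M (dil f) (dil g)"
  by (auto simp: agree_def dil_nth)

lemma agree_imp_eq: "(\<And>M. agree M f g) \<Longrightarrow> f = g"
  by (rule fps_ext) (metis agree_def lessI)

lemma unit_fps: "u $ 0 = 1 \<Longrightarrow> \<exists>v. u * v = 1" for u :: "'r::comm_ring_1 fps"
  using fps_right_inverse [of u 1] by auto

lemma agree_cancel:
  fixes u :: "'r::comm_ring_1 fps"
  assumes "u $ 0 = 1" "agree M (u * f) (u * g)"
  shows "agree M f g"
proof -
  obtain v where v: "u * v = 1" using unit_fps [OF assms(1)] by blast
  have "agree M (v * (u * f)) (v * (u * g))"
    by (rule agree_mult [OF agree_refl assms(2)])
  moreover have "v * (u * h) = h" for h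
    using v by (metis mult.assoc mult.commute mult_1)
  ultimately show ?thesis by simp
qed

text \<open>The polynomial variable plays the role of z in the triple product, and agreement modulo
  q^M is required of each coefficient separately.\<close>

definition pagree :: "nat \<Rightarrow> 'r::comm_ring_1 fps poly \<Rightarrow> 'r fps poly \<Rightarrow> bool" where
  "pagree M p q \<longleftrightarrow> (\<forall>j. agree M (coeff p j) (coeff q j))"

lemma pagree_mult: "pagree M p q \<Longrightarrow> pagree M p' q' \<Longrightarrow> pagree M (p * p') (q * q')"
  by (auto simp: pagree_def coeff_mult intro!: agree_sum agree_mult)

lemma pagree_power: "pagree M p q \<Longrightarrow> pagree M (p ^ n) (q ^ n)"
  by (induction n) (auto intro: pagree_mult simp: pagree_def [of _ 1 1])

definition dilate :: "'r::comm_ring_1 \<Rightarrow> 'r poly \<Rightarrow> 'r poly" where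
  "dilate c p = pcompose p [:0, c:]"

lemma coeff_dilate: "coeff (dilate c p) j = c ^ j * coeff p j"
  by (simp add: dilate_def coeff_pcompose_linear)

lemma dilate_mult: "dilate c (p * q) = dilate c p * dilate c q"
  by (simp add: dilate_def pcompose_mult)

lemma dilate_prod: "dilate c (prod f A) = (\<Prod>i\<in>A. dilate c (f i))"
  by (simp add: dilate_def pcompose_prod)

lemma dilate_linear: "dilate c [:a, b:] = [:a, b * c:]"
  by (simp add: dilate_def pcompose_pCons mult.commute)

lemma pagree_dilate: "pagree M p q \<Longrightarrow> pagree M (dilate c p) (dilate c q)"
  by (auto simp: pagree_def coeff_dilate intro: agree_mult)

section \<open>Euler products and the finite q-binomial theorem\<close>

definition euler_prod :: "nat \<Rightarrow> 'r::comm_ring_1 fps" where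
  "euler_prod n = (\<Prod>i\<in>{1..n}. 1 - fps_X ^ i)"

definition euler :: "'r::comm_ring_1 fps" where
  "euler = Abs_fps (\<lambda>n. euler_prod n $ n)"

lemma euler_prod_0 [simp]: "euler_prod 0 = 1"
  by (simp add: euler_prod_def)

lemma euler_prod_Suc: "euler_prod (Suc n) = euler_prod n * (1 - fps_X ^ Suc n)"
  by (simp add: euler_prod_def mult.commute)

lemma agree_euler_prod: "n \<le> m \<Longrightarrow> agree (Suc n) (euler_prod n) (euler_prod m :: 'r::comm_ring_1 fps)"
proof (induction m rule: dec_induct)
  case (step m)
  have "euler_prod (Suc m) = (euler_prod m - fps_X ^ Suc m * euler_prod m :: 'r fps)"
    by (simp add: euler_prod_Suc algebra_simps)
  with step show ?case by (auto simp: agree_def fps_X_power_mult_nth simp del: power_Suc)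
qed simp

lemma agree_euler: "agree (Suc n) euler (euler_prod n :: 'r::comm_ring_1 fps)"
  unfolding agree_def
proof (intro allI impI)
  fix i assume "i < Suc n"
  then have "agree (Suc i) (euler_prod i) (euler_prod n :: 'r fps)" by (intro agree_euler_prod) simp
  then show "euler $ i = (euler_prod n :: 'r fps) $ i"
    by (simp add: euler_def agree_def)
qed

lemma euler_prod_nth_0 [simp]: "euler_prod n $ 0 = 1"
  using agree_euler_prod [of 0 n] by (simp add: agree_def)

lemma euler_nth_0 [simp]: "euler $ 0 = 1"
  by (simp add: euler_def)

definition ts :: "nat \<Rightarrow> nat" where "ts n = \<Sum>{..<n}"

lemma ts_simps [simp]: "ts 0 = 0" "ts (Suc n) = ts n + n"
  by (simp_all add: ts_def)

lemma two_ts: "2 * int (ts n) = int n * (int n - 1)"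
  by (induction n) (simp_all add: algebra_simps)

definition binom_prod :: "nat \<Rightarrow> 'r::comm_ring_1 fps poly" where
  "binom_prod n = (\<Prod>i<n. [:1, fps_X ^ i:])"

lemma coeff_binom_prod_gt: "n < j \<Longrightarrow> coeff (binom_prod n) j = (0 :: 'r::comm_ring_1 fps)"
proof (induction n arbitrary: j)
  case (Suc n)
  have "binom_prod (Suc n) = ([:1, fps_X ^ n:] * binom_prod n :: 'r fps poly)"
    by (simp add: binom_prod_def mult.commute)
  with Suc show ?case by (cases j) simp_all
qed (simp add: binom_prod_def)

text \<open>The finite q-binomial theorem with denominators cleared; the induction is the q-Pascal
  rule.\<close>

lemma coeff_binom_prod:
  "j \<le> n \<Longrightarrow> coeff (binom_prod n) j * euler_prod j * euler_prod (n - j) = (fps_X ^ ts j * euler_prod n :: 'r::comm_ring_1 fps)"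
proof (induction n arbitrary: j)
  case (Suc n)
  have rec: "binom_prod (Suc n) = ([:1, fps_X ^ n:] * binom_prod n :: 'r fps poly)"
    by (simp add: binom_prod_def mult.commute)
  show ?case
  proof (cases j)
    case 0
    have "coeff (binom_prod n) 0 = (1 :: 'r fps)" for n
      by (simp add: binom_prod_def poly_prod flip: poly_0_coeff_0)
    with 0 show ?thesis by simp
  next
    case (Suc i)
    have IH: "coeff (binom_prod n) i * euler_prod i * euler_prod (n - i)
        = (fps_X ^ ts i * euler_prod n :: 'r fps)"
      using Suc.prems Suc.IH [of i] \<open>j = Suc i\<close> by simp
    show ?thesis
    proof (cases "i = n")
      case True
      have "coeff (binom_prod (Suc n)) j = (fps_X ^ n * coeff (binom_prod n) i :: 'r fps)"
        using Suc True by (simp add: rec coeff_binom_prod_gt)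
      then have "coeff (binom_prod (Suc n)) j * euler_prod j * euler_prod (Suc n - j)
          = (fps_X ^ n * (coeff (binom_prod n) i * euler_prod i * euler_prod (n - i)) * (1 - fps_X ^ Suc n) :: 'r fps)"
        using True Suc by (simp add: euler_prod_Suc ac_simps del: power_Suc)
      then show ?thesis
        unfolding IH using Suc True by (simp add: euler_prod_Suc power_add ac_simps del: power_Suc)
    next
      case False
      with Suc Suc.prems have "i < n" by simp
      then obtain m where m: "n = Suc i + m" by (metis less_iff_Suc_add add_Suc)
      have IH': "coeff (binom_prod n) (Suc i) * euler_prod (Suc i) * euler_prod m
          = (fps_X ^ ts (Suc i) * euler_prod n :: 'r fps)"
        using Suc.IH [of "Suc i"] m by simp
      have IH'': "coeff (binom_prod n) i * euler_prod i * euler_prod (Suc m)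
        = (fps_X ^ ts i * euler_prod n :: 'r fps)"
        using IH m by (simp add: Suc_diff_le)
      have c: "coeff (binom_prod (Suc n)) j
          = (coeff (binom_prod n) (Suc i) + fps_X ^ n * coeff (binom_prod n) i :: 'r fps)"
        using Suc by (simp add: rec)
      have "coeff (binom_prod (Suc n)) j * euler_prod j * euler_prod (Suc n - j)
        = (coeff (binom_prod n) (Suc i) * euler_prod (Suc i) * euler_prod m * (1 - fps_X ^ Suc m)
          + fps_X ^ n * (coeff (binom_prod n) i * euler_prod i * euler_prod (Suc m)) * (1 - fps_X ^ Suc i) :: 'r fps)"
        unfolding c using Suc m by (simp add: euler_prod_Suc algebra_simps del: power_Suc)
      also have "\<dots> = fps_X ^ ts i * euler_prod n * (fps_X ^ i * (1 - fps_X ^ Suc m) + fps_X ^ n * (1 - fps_X ^ Suc i))"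
        unfolding IH' IH'' by (simp add: power_add algebra_simps)
      \<comment> \<open>With n = i + 1 + m the two middle terms cancel.\<close>
      also have "fps_X ^ i * (1 - fps_X ^ Suc m) + fps_X ^ n * (1 - fps_X ^ Suc i)
          = (fps_X ^ i * (1 - fps_X ^ Suc n) :: 'r fps)"
        by (simp add: m algebra_simps power_add)
      finally show ?thesis
        using Suc by (simp add: euler_prod_Suc power_add ac_simps del: power_Suc)
    qed
  qed
qed (simp add: binom_prod_def)

text \<open>Since q^n + z = z (1 + q^n / z), this is the finite Jacobi product times z^N, so
  coefficient \<open>N\<close> here stands for the power z^0.\<close>

definition theta_prod :: "nat \<Rightarrow> 'r::comm_ring_1 fps poly" where
  "theta_prod N = (\<Prod>n<N. [:1, fps_X ^ Suc n:] * [:fps_X ^ n, 1:])"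

lemma prod_lessThan_add: "prod f {..<m + n} = prod f {..<m} * prod (\<lambda>i. f (m + i)) {..<n}"
  for f :: "nat \<Rightarrow> 'r::comm_monoid_mult"
  by (induction n) (simp_all add: mult.assoc)

lemma prod_mult_smult:
  fixes f g :: "nat \<Rightarrow> 'r::comm_ring_1 poly"
  shows "(\<Prod>n<N. f n * smult (c n) (g n)) = smult (\<Prod>n<N. c n) ((\<Prod>n<N. g n) * (\<Prod>n<N. f n))"
  by (induction N) (simp_all add: mult_ac)

text \<open>After z is replaced by q^(N-1) z the second factors are q^n (1 + q^(N-1-n) z), and
  together with the first ones they run through all 1 + q^i z with i < 2 N.\<close>

lemma dilate_theta_prod:
  assumes "N > 0"
  shows "dilate (fps_X ^ (N - 1)) (theta_prod N) = smult (fps_X ^ ts N) (binom_prod (2 * N))"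
proof -
  have "dilate (fps_X ^ (N - 1)) (theta_prod N)
      = (\<Prod>n<N. [:1, fps_X ^ (N + n):] * smult (fps_X ^ n) [:1, fps_X ^ (N - Suc n):])"
    unfolding theta_prod_def dilate_prod
  proof (rule prod.cong)
    fix n assume "n \<in> {..<N}"
    then have "Suc n + (N - 1) = N + n" "n + (N - Suc n) = N - 1" by auto
    then show "dilate (fps_X ^ (N - 1)) ([:1, fps_X ^ Suc n:] * [:fps_X ^ n, 1:])
      = [:1, fps_X ^ (N + n):] * smult (fps_X ^ n) [:1, fps_X ^ (N - Suc n):]"
      unfolding dilate_mult dilate_linear power_add [symmetric] smult_pCons by (simp add: add.commute)
  qed simp
  also have "\<dots> = smult (\<Prod>n<N. fps_X ^ n) ((\<Prod>n<N. [:1, fps_X ^ (N - Suc n):]) * (\<Prod>n<N. [:1, fps_X ^ (N + n):]))"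
    by (rule prod_mult_smult)
  also have "(\<Prod>n<N. [:1, fps_X ^ (N - Suc n):]) = (\<Prod>n<N. [:1, fps_X ^ n:])"
    by (rule prod.nat_diff_reindex)
  also have "(\<Prod>n<N. [:1, fps_X ^ n:]) * (\<Prod>n<N. [:1, fps_X ^ (N + n):]) = binom_prod (N + N)"
    by (simp only: binom_prod_def prod_lessThan_add)
  also have "(\<Prod>n<N. fps_X ^ n) = fps_X ^ ts N"
    by (simp add: ts_def power_sum)
  finally show ?thesis by (simp add: mult_2)
qed

lemma coeff_theta_prod:
  fixes N :: nat
  assumes "j \<le> 2 * N"
  shows "coeff (theta_prod N) j * euler_prod j * euler_prod (2 * N - j)
    = (fps_X ^ nat (tr (int j - int N)) * euler_prod (2 * N) :: 'r::idom fps)"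
proof (cases "N = 0")
  case True
  with assms show ?thesis by (simp add: theta_prod_def tr_def)
next
  case False
  have exp: "ts N + ts j = (N - 1) * j + nat (tr (int j - int N))"
  proof -
    obtain n where N: "N = Suc n" using False by (cases N) auto
    have "2 * int (ts N + ts j) = 2 * int ((N - 1) * j + nat (tr (int j - int N)))"
      using two_ts [of N] two_ts [of j] two_tr [of "int j - int N"] tr_bounds(1) [of "int j - int N"]
      unfolding N by (simp add: algebra_simps)
    then have "int (ts N + ts j) = int ((N - 1) * j + nat (tr (int j - int N)))"
      by (simp only: mult_cancel_left) simp
    then show ?thesis by (simp only: of_nat_eq_iff)
  qed
  have "fps_X ^ ((N - 1) * j) * coeff (theta_prod N) j = (fps_X ^ ts N * coeff (binom_prod (2 * N)) j :: 'r fps)"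
    using arg_cong [OF dilate_theta_prod [of N], of "\<lambda>p. coeff p j"] False
    by (simp add: coeff_dilate power_mult)
  then have "fps_X ^ ((N - 1) * j) * (coeff (theta_prod N) j * euler_prod j * euler_prod (2 * N - j))
      = (fps_X ^ ts N * (coeff (binom_prod (2 * N)) j * euler_prod j * euler_prod (2 * N - j)) :: 'r fps)"
    by (metis (no_types, lifting) mult.assoc)
  also have "\<dots> = fps_X ^ (ts N + ts j) * euler_prod (2 * N)"
    by (simp only: coeff_binom_prod [OF assms]) (simp add: power_add mult.assoc)
  also have "\<dots> = fps_X ^ ((N - 1) * j) * (fps_X ^ nat (tr (int j - int N)) * euler_prod (2 * N))"
    unfolding exp by (simp add: power_add mult.assoc)
  finally show ?thesis by simp
qed

lemma coeff_theta_prod_gt: "2 * N < j \<Longrightarrow> coeff (theta_prod N) j = (0 :: 'r::comm_ring_1 fps)"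
proof (rule coeff_eq_0)
  have "degree (theta_prod N :: 'r fps poly) \<le> 2 * N"
  proof (induction N)
    case (Suc N)
    have eq: "theta_prod (Suc N) = (theta_prod N * ([:1, fps_X ^ Suc N:] * [:fps_X ^ N, 1:]) :: 'r fps poly)"
      by (simp add: theta_prod_def)
    have "degree ([:1, fps_X ^ Suc N:] * [:fps_X ^ N, 1:] :: 'r fps poly) \<le> 1 + 1"
      by (rule order_trans [OF degree_mult_le add_mono]) (auto simp: degree_pCons_eq_if)
    from order_trans [OF degree_mult_le add_mono [OF Suc this]] show ?case
      unfolding eq by simp
  qed (simp add: theta_prod_def)
  then show "2 * N < j \<Longrightarrow> degree (theta_prod N :: 'r fps poly) < j" by simp
qed

definition theta_sum :: "nat \<Rightarrow> 'r::comm_ring_1 fps poly" where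
  "theta_sum N = (\<Sum>x\<in>{- int N..int N}. monom (fps_X ^ nat (tr x)) (nat (x + int N)))"

lemma coeff_theta_sum:
  "coeff (theta_sum N) j = (if j \<le> 2 * N then fps_X ^ nat (tr (int j - int N)) else 0)"
proof -
  have "coeff (theta_sum N) j = (\<Sum>x\<in>{- int N..int N}. if x = int j - int N then fps_X ^ nat (tr x) else 0)"
    unfolding theta_sum_def coeff_sum by (rule sum.cong) auto
  then show ?thesis by (auto simp: sum.delta)
qed

text \<open>If \<open>j\<close> and \<open>2 * N - j\<close> are both at least \<open>M\<close>, all
  finite Euler products in \<open>coeff_theta_prod\<close> agree with \<open>euler\<close> and one
  copy cancels. Otherwise \<open>2 * M \<le> N\<close> puts \<open>j\<close> so far from the centre
  \<open>N\<close> that the triangular exponent is at least \<open>M\<close> and both sides vanish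
  modulo q^M.\<close>

lemma jacobi_triple:
  assumes "2 * M \<le> N"
  shows "pagree M (smult euler (theta_prod N)) (theta_sum N :: 'r::idom fps poly)"
  unfolding pagree_def
proof
  fix j
  show "agree M (coeff (smult euler (theta_prod N)) j) (coeff (theta_sum N) j :: 'r fps)"
  proof (cases "j \<le> 2 * N")
    case False
    then show ?thesis by (simp add: coeff_theta_sum coeff_theta_prod_gt)
  next
    case True
    let ?h = "coeff (theta_prod N) j :: 'r fps"
    let ?t = "nat (tr (int j - int N))"
    note eq = coeff_theta_prod [OF True, where ?'r = 'r]
    show ?thesis
    proof (cases "M \<le> j \<and> M \<le> 2 * N - j")
      case True
      have E: "agree M euler (euler_prod n :: 'r fps)" if "M \<le> n" for n
        by (rule agree_mono [OF agree_euler]) (use that in simp)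
      have "agree M (euler * (euler * ?h)) (?h * euler_prod j * euler_prod (2 * N - j))"
        using agree_mult [OF E [of j] agree_mult [OF E [of "2 * N - j"] agree_refl [of M ?h]]] True
        by (simp add: mult_ac)
      also have "agree M (?h * euler_prod j * euler_prod (2 * N - j)) (fps_X ^ ?t * euler)"
        unfolding eq using assms by (intro agree_mult agree_refl agree_sym [OF E]) simp
      finally have "agree M (euler * (euler * ?h)) (euler * fps_X ^ ?t)" by (simp add: mult.commute)
      then have "agree M (euler * ?h) (fps_X ^ ?t)" by (rule agree_cancel [rotated]) simp
      with \<open>j \<le> 2 * N\<close> show ?thesis by (simp add: coeff_theta_sum)
    next
      case False
      then have "M \<le> ?t"
        using tr_bounds [of "int j - int N"] \<open>j \<le> 2 * N\<close> assms by linarith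
      then have t: "agree M (fps_X ^ ?t * f) 0" for f :: "'r fps" by (rule agree_X_power)
      have "agree M (euler_prod j * euler_prod (2 * N - j) * ?h) (euler_prod j * euler_prod (2 * N - j) * 0)"
      proof -
        have "euler_prod j * euler_prod (2 * N - j) * ?h = fps_X ^ ?t * euler_prod (2 * N)"
          using eq by (simp only: mult_ac)
        then show ?thesis by (simp only: t mult_zero_right)
      qed
      then have "agree M ?h 0" by (rule agree_cancel [rotated]) (simp add: fps_mult_nth_0)
      then have "agree M (euler * ?h) (euler * 0)" by (rule agree_mult [OF agree_refl])
      also have "agree M (euler * 0) (fps_X ^ ?t :: 'r fps)" using agree_sym [OF t [of 1]] by simp
      finally show ?thesis using \<open>j \<le> 2 * N\<close> by (simp add: coeff_theta_sum)
    qed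
  qed
qed

lemma sum_monom_mult:
  "(\<Sum>x\<in>A. monom (f x) (d x)) * (\<Sum>y\<in>B. monom (g y) (e y))
    = (\<Sum>(x, y)\<in>A \<times> B. monom (f x * g y) (d x + e y))"
  by (simp add: sum_product sum.cartesian_product mult_monom)

text \<open>The z^0 coefficient of the finite product approximates 1 / E; its dilation is what has
  to be cancelled when E^3 is dissected.\<close>

lemma agree_euler_theta_prod:
  assumes "2 * M \<le> N"
  shows "agree M (euler * coeff (theta_prod N) N) (1 :: 'r::idom fps)"
proof -
  have "agree M (coeff (smult euler (theta_prod N)) N) (coeff (theta_sum N) N :: 'r fps)"
    using jacobi_triple [OF assms, where ?'r = 'r] by (simp only: pagree_def)
  moreover have "coeff (theta_sum N) N = (1 :: 'r fps)"
    by (simp add: coeff_theta_sum tr_def)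
  ultimately show ?thesis by simp
qed

text \<open>A finite theta sum with coefficient \<open>c\<close>, q-exponent \<open>w\<close> and
  z-exponent \<open>d\<close>. Keeping the index set explicit turns a product of such sums into one
  sum over lattice points.\<close>

definition wt :: "'i set \<Rightarrow> ('i \<Rightarrow> 'r) \<Rightarrow> ('i \<Rightarrow> int) \<Rightarrow> ('i \<Rightarrow> nat) \<Rightarrow> 'r::comm_ring_1 fps poly" where
  "wt A c w d = (\<Sum>s\<in>A. monom (fps_const (c s) * fps_X ^ nat (w s)) (d s))"

lemma wt_mult:
  assumes "\<And>s. s \<in> A \<Longrightarrow> 0 \<le> w s" "\<And>s. s \<in> B \<Longrightarrow> 0 \<le> w' s"
  shows "wt A c w d * wt B c' w' d' =
    wt (A \<times> B) (\<lambda>(s, t). c s * c' t) (\<lambda>(s, t). w s + w' t) (\<lambda>(s, t). d s + d' t)"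
  unfolding wt_def sum_monom_mult
  by (intro sum.cong refl)
    (use assms in \<open>auto simp: nat_add_distrib power_add mult_ac simp flip: fps_const_mult\<close>)

lemma coeff_wt:
  assumes "finite A" "\<And>s. s \<in> A \<Longrightarrow> 0 \<le> w s"
  shows "coeff (wt A c w d) j $ n = (\<Sum>s\<in>{s \<in> A. d s = j \<and> w s = int n}. c s)"
proof -
  have "coeff (wt A c w d) j $ n = (\<Sum>s\<in>A. if d s = j \<and> w s = int n then c s else 0)"
    unfolding wt_def coeff_sum fps_sum_nth by (rule sum.cong) (use assms(2) in auto)
  also have "\<dots> = (\<Sum>s\<in>{s \<in> A. d s = j \<and> w s = int n}. c s)"
    by (rule sum.inter_filter [symmetric, OF assms(1)])
  finally show ?thesis .
qed

lemma dilate_theta_sum: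
  "dilate (fps_const u) (theta_sum N)
    = wt {- int N..int N} (\<lambda>x. u ^ nat (x + int N)) tr (\<lambda>x. nat (x + int N))"
proof (rule poly_eqI)
  fix j
  show "coeff (dilate (fps_const u) (theta_sum N)) j
    = coeff (wt {- int N..int N} (\<lambda>x. u ^ nat (x + int N)) tr (\<lambda>x. nat (x + int N))) j"
    by (auto simp: coeff_dilate theta_sum_def wt_def coeff_sum sum_distrib_left intro!: sum.cong)
qed

lemma theta_sum_wt: "theta_sum N = wt {- int N..int N} (\<lambda>x. 1) tr (\<lambda>x. nat (x + int N))"
  by (simp add: theta_sum_def wt_def)

lemma w3_range:
  assumes "w3 (x, y, z) = int n" "n < N"
  shows "x \<in> {- int N..int N}" "y \<in> {- int N..int N}" "z \<in> {- int N..int N}"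
proof -
  have "tr x + tr y + tr z = int n" using assms(1) by (simp add: w3_def)
  then show "x \<in> {- int N..int N}" "y \<in> {- int N..int N}" "z \<in> {- int N..int N}"
    using assms(2) tr_bounds [of x] tr_bounds [of y] tr_bounds [of z]
    unfolding atLeastAtMost_iff by linarith+
qed

text \<open>With \<open>\<omega>\<close> a primitive cube root of unity, the three substitutions \<open>z, \<omega> z, \<omega>\<^sup>2 z\<close> multiply
  the triple product to the triple product in \<open>q\<^sup>3\<close> and \<open>z\<^sup>3\<close>.\<close>

lemma coeff_cubic_factor:
  fixes p q :: "'r::idom fps poly"
  assumes "\<And>j. coeff p j = (if 3 dvd j then dil (coeff q (j div 3)) else 0)"
  shows "coeff ([:dil u, 0, 0, dil v:] * p) j = (if 3 dvd j then dil (coeff ([:u, v:] * q) (j div 3)) else 0)"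
proof -
  consider "j = 0" | "j = 1" | "j = 2" | i where "j = Suc (Suc (Suc i))"
    by (metis One_nat_def Suc_1 not0_implies_Suc)
  then show ?thesis
  proof cases
    case (4 i)
    have "Suc (Suc (Suc i)) div 3 = Suc (i div 3)" "3 dvd Suc (Suc (Suc i)) \<longleftrightarrow> 3 dvd i"
      by presburger+
    then show ?thesis unfolding 4 by (simp add: assms)
  qed (simp_all add: assms numeral_2_eq_2)
qed

lemma cubic_factor:
  fixes w u v :: "'r::idom"
  assumes "w ^ 2 + w + 1 = 0"
  shows "[:u, v:] * ([:u, v * w:] * [:u, v * w ^ 2:]) = [:u ^ 3, 0, 0, v ^ 3:]"
proof -
  have w3: "w ^ 3 = 1" using assms by algebra
  have "u * (u * (v * w ^ 2)) + u * (v * w * u) + v * (u * u) = u ^ 2 * v * (w ^ 2 + w + 1)" by algebra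
  also have "\<dots> = 0" by (simp add: assms)
  finally have 1: "u * (u * (v * w ^ 2)) + u * (v * w * u) + v * (u * u) = 0" .
  have "u * (v * w * (v * w ^ 2)) + v * (u * (v * w ^ 2)) + v * (v * w * u)
      = u * v ^ 2 * (w ^ 3 + w ^ 2 + w)" by algebra
  also have "\<dots> = u * v ^ 2 * (w ^ 2 + w + 1)" by (simp add: w3 add_ac)
  also have "\<dots> = 0" by (simp add: assms)
  finally have 2: "u * (v * w * (v * w ^ 2)) + v * (u * (v * w ^ 2)) + v * (v * w * u) = 0" .
  have 3: "v * (v * w * (v * w ^ 2)) = v ^ 3"
    using w3 by algebra
  show ?thesis
    using 1 2 3 by (simp add: algebra_simps power3_eq_cube)
qed

lemma coeff_theta_prod_cubic:
  fixes w :: "'r::idom"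
  assumes w: "w ^ 2 + w + 1 = 0"
  shows "coeff (theta_prod N * (dilate (fps_const w) (theta_prod N) * dilate (fps_const (w ^ 2)) (theta_prod N))) j
    = (if 3 dvd j then dil (coeff (theta_prod N) (j div 3)) else 0)"
proof (induction N arbitrary: j)
  case 0
  show ?case by (auto simp: theta_prod_def dilate_def pcompose_1 simp flip: one_pCons)
next
  case (Suc N)
  let ?P = "\<lambda>N. theta_prod N * (dilate (fps_const w) (theta_prod N) * dilate (fps_const (w ^ 2)) (theta_prod N))"
  have rec: "theta_prod (Suc N) = ([:1, fps_X ^ Suc N:] * ([:fps_X ^ N, 1:] * theta_prod N) :: 'r fps poly)"
    by (simp only: theta_prod_def prod.lessThan_Suc mult_ac)
  have w': "fps_const w ^ 2 + fps_const w + 1 = 0"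
    using arg_cong [OF w, of fps_const] by (simp add: fps_const_power flip: fps_const_add)
  note cf = cubic_factor [OF w', unfolded fps_const_power]
  have dil_X: "dil (fps_X ^ m) = ((fps_X ^ m) ^ 3 :: 'r fps)" for m :: nat
    by (simp flip: power_mult add: mult.commute)
  have "?P (Suc N) = ([:1, fps_X ^ Suc N:] * ([:1, fps_X ^ Suc N * fps_const w:] * [:1, fps_X ^ Suc N * fps_const (w ^ 2):])) *
      (([:fps_X ^ N, 1:] * ([:fps_X ^ N, 1 * fps_const w:] * [:fps_X ^ N, 1 * fps_const (w ^ 2):])) * ?P N)"
    unfolding rec dilate_mult dilate_linear by (simp only: mult_ac)
  also have "\<dots> = [:dil 1, 0, 0, dil (fps_X ^ Suc N):] * ([:dil (fps_X ^ N), 0, 0, dil 1:] * ?P N)"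
    unfolding cf dil_X by (simp only: dil_simps power_one)
  finally show ?case
    unfolding rec using coeff_cubic_factor [OF coeff_cubic_factor [OF Suc.IH]] by (simp only:)
qed

text \<open>Compare the z^0 coefficients, at index 3 N, in the product of the triple products at z,
  w z and w^2 z. On the product side this is E^3 times an approximation of 1 / E(q^3). On the sum
  side a triple of sum 0 carries w^(x - y); classes 1 and 2 have equal series and w + w^2 =
  -1.\<close>

theorem euler_cube:
  fixes w :: "'r::idom"
  assumes w: "w ^ 2 + w + 1 = 0"
  shows "(euler :: 'r fps) ^ 3 = dil euler * (dil cubic_a - 3 * fps_X * dil cubic_c)"
proof (rule agree_imp_eq)
  fix M
  define N :: nat where "N = 2 * M + 1"
  let ?I = "{- int N..int N}"
  let ?T = "theta_sum N * (dilate (fps_const w) (theta_sum N) * dilate (fps_const (w ^ 2)) (theta_sum N)) :: 'r fps poly"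
  define H where "H = (theta_prod N :: 'r fps poly)"
  have w3: "w ^ 3 = 1" using w by algebra
  have J: "pagree M (smult euler H) (theta_sum N)" unfolding H_def by (rule jacobi_triple) (simp add: N_def)
  have "smult euler H * (dilate (fps_const w) (smult euler H) * dilate (fps_const (w ^ 2)) (smult euler H))
    = smult (euler ^ 3) (H * (dilate (fps_const w) H * dilate (fps_const (w ^ 2)) H))"
    by (simp add: dilate_def pcompose_smult power3_eq_cube)
  then have "pagree M (smult (euler ^ 3) (H * (dilate (fps_const w) H * dilate (fps_const (w ^ 2)) H))) ?T"
    using pagree_mult [OF J pagree_mult [OF pagree_dilate [OF J] pagree_dilate [OF J]]] by metis
  then have "agree M (coeff (smult (euler ^ 3) (H * (dilate (fps_const w) H * dilate (fps_const (w ^ 2)) H))) (3 * N)) (coeff ?T (3 * N))"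
    by (simp add: pagree_def)
  then have 1: "agree M (euler ^ 3 * dil (coeff H N)) (coeff ?T (3 * N))"
    unfolding coeff_smult H_def coeff_theta_prod_cubic [OF w] by simp
  have "agree M (euler * coeff H N) 1" unfolding H_def by (rule agree_euler_theta_prod) (simp add: N_def)
  then have 2: "agree M (dil euler * dil (coeff H N)) 1" using agree_dil by fastforce
  have "agree M (euler ^ 3) (euler ^ 3 * (dil euler * dil (coeff H N)))"
    using agree_mult [OF agree_refl agree_sym [OF 2], of "euler ^ 3"] by simp
  also have "agree M \<dots> (dil euler * coeff ?T (3 * N))"
    using agree_mult [OF agree_refl 1, of "dil euler"] by (simp add: mult_ac)
  finally have 3: "agree M (euler ^ 3) (dil euler * coeff ?T (3 * N))" .
  have "agree M (coeff ?T (3 * N)) (gf (tri_mod 0 0) w3 + fps_const w * gf (tri_mod 0 1) w3 + fps_const (w ^ 2) * gf (tri_mod 0 2) w3)"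
    unfolding agree_def
  proof (intro allI impI)
    fix n assume "n < M"
    then have range: "n < N" by (simp add: N_def)
    let ?A = "{p \<in> tri 0. w3 p = int n}"
    let ?c = "\<lambda>(x, y, z). w ^ (nat (y + int N) + 2 * nat (z + int N)) :: 'r"
    have T: "?T = wt (?I \<times> ?I \<times> ?I) (\<lambda>(x, y, z). 1 * (w ^ nat (y + int N) * (w ^ 2) ^ nat (z + int N)))
        (\<lambda>(x, y, z). tr x + (tr y + tr z)) (\<lambda>(x, y, z). nat (x + int N) + (nat (y + int N) + nat (z + int N)))"
      unfolding dilate_theta_sum unfolding theta_sum_wt by (simp add: wt_mult tr_bounds case_prod_unfold)
    have "coeff ?T (3 * N) $ n = (\<Sum>p\<in>?A. ?c p)"
      unfolding T
    proof (subst coeff_wt)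
      show "(\<Sum>s\<in>{s \<in> ?I \<times> ?I \<times> ?I.
          (case s of (x, y, z) \<Rightarrow> nat (x + int N) + (nat (y + int N) + nat (z + int N))) = 3 * N \<and>
          (case s of (x, y, z) \<Rightarrow> tr x + (tr y + tr z)) = int n}.
          (case s of (x, y, z) \<Rightarrow> 1 * (w ^ nat (y + int N) * (w ^ 2) ^ nat (z + int N)))) = (\<Sum>p\<in>?A. ?c p)"
      proof (rule sum.cong)
        show "{s \<in> ?I \<times> ?I \<times> ?I.
          (case s of (x, y, z) \<Rightarrow> nat (x + int N) + (nat (y + int N) + nat (z + int N))) = 3 * N \<and>
          (case s of (x, y, z) \<Rightarrow> tr x + (tr y + tr z)) = int n} = ?A" (is "?L = ?R")
        proof (intro equalityI subsetI)
          fix p assume "p \<in> ?L"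
          then show "p \<in> ?R" by (auto simp: tri_def w3_def add.assoc)
        next
          fix p assume "p \<in> ?R"
          moreover obtain x y z where p: "p = (x, y, z)" by (rule prod_cases3)
          ultimately have xyz: "x + y + z = 0" "w3 (x, y, z) = int n" by (auto simp: tri_def)
          have r: "x \<in> ?I" "y \<in> ?I" "z \<in> ?I" using w3_range [OF xyz(2) range] by simp_all
          then have "int (nat (x + int N) + (nat (y + int N) + nat (z + int N))) = int (3 * N)"
            using xyz(1) by simp
          then have "nat (x + int N) + (nat (y + int N) + nat (z + int N)) = 3 * N"
            by (simp only: of_nat_eq_iff)
          then show "p \<in> ?L"
            using r xyz(2) by (simp add: p w3_def add.assoc)
        qed
      qed (auto simp: power_add power_mult)
    qed (auto simp: tr_bounds)
    also have "\<dots> = (\<Sum>(x, y, z)\<in>?A. w ^ nat ((x - y) mod 3))"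
    proof (rule sum.cong)
      fix p assume p: "p \<in> ?A"
      obtain x y z where [simp]: "p = (x, y, z)" by (rule prod_cases3)
      let ?m = "nat (y + int N) + 2 * nat (z + int N)"
      \<comment> \<open>The exponent y + 2 z + 3 N is rewritten with x + y + z = 0, so that its
        class modulo 3 is the one used in \<open>tri_mod\<close>.\<close>
      have "int ?m = (x - y) + 3 * (y + z + int N)"
        using p w3_range [of x y z n N] range by (simp add: tri_def)
      then have "int ?m mod 3 = (x - y) mod 3" by (simp only: mod_mult_self2)
      then have "?m mod 3 = nat ((x - y) mod 3)" by (metis nat_int of_nat_mod of_nat_numeral)
      moreover have "w ^ ?m = w ^ (?m mod 3)"
        by (metis mult_div_mod_eq power_add power_mult power_one mult_1 w3)
      ultimately show "?c p = (case p of (x, y, z) \<Rightarrow> w ^ nat ((x - y) mod 3))" by simp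
    qed simp
    also have "\<dots> = (\<Sum>r\<in>{0, 1, 2}. \<Sum>(x, y, z)\<in>{p \<in> tri_mod 0 r. w3 p = int n}. w ^ nat ((x - y) mod 3))"
    proof (subst sum.UNION_disjoint [symmetric])
      show "\<forall>r\<in>{0, 1, 2}. finite {p \<in> tri_mod 0 r. w3 p = int n}"
        using graded_w3 by (auto simp: graded_def)
      have "?A = (\<Union>r\<in>{0, 1, 2}. {p \<in> tri_mod 0 r. w3 p = int n})"
        using tri_UN_tri_mod [of 0] by auto
      then show "(\<Sum>(x, y, z)\<in>?A. w ^ nat ((x - y) mod 3))
          = (\<Sum>(x, y, z)\<in>(\<Union>r\<in>{0, 1, 2}. {p \<in> tri_mod 0 r. w3 p = int n}). w ^ nat ((x - y) mod 3))"
        by (rule sum.cong) simp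
    qed (auto simp: tri_mod_def)
    also have "\<dots> = (\<Sum>r\<in>{0, 1, 2 :: int}. \<Sum>p\<in>{p \<in> tri_mod 0 r. w3 p = int n}. w ^ nat r)"
      by (intro sum.cong refl) (auto simp: tri_mod_def)
    also have "\<dots> = (gf (tri_mod 0 0) w3 + fps_const w * gf (tri_mod 0 1) w3 + fps_const (w ^ 2) * gf (tri_mod 0 2) w3) $ n"
      by (simp add: gf_nth mult.commute)
    finally show "coeff ?T (3 * N) $ n = (gf (tri_mod 0 0) w3 + fps_const w * gf (tri_mod 0 1) w3
        + fps_const (w ^ 2) * gf (tri_mod 0 2) w3) $ n" .
  qed
  also have "gf (tri_mod 0 0) w3 + fps_const w * gf (tri_mod 0 1) w3 + fps_const (w ^ 2) * gf (tri_mod 0 2) w3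
      = dil cubic_a - 3 * fps_X * dil cubic_c"
  proof -
    have "fps_const (w ^ 2) + fps_const w + 1 = 0"
      using arg_cong [OF w, of fps_const] by (simp flip: fps_const_add)
    then show ?thesis
      unfolding gf_tri_0_mod_0 gf_tri_0_mod_1 gf_tri_0_mod_2 dil_simps by algebra
  qed
  finally show "agree M ((euler :: 'r fps) ^ 3) (dil euler * (dil cubic_a - 3 * fps_X * dil cubic_c))"
    using agree_trans [OF 3 agree_mult [OF agree_refl]] by blast
qed

section \<open>The norm of the Euler product\<close>

definition rot :: "'r::comm_ring_1 \<Rightarrow> 'r fps \<Rightarrow> 'r fps" where
  "rot w f = fps_compose f (fps_const w * fps_X)"

lemma rot_nth: "rot w f $ n = w ^ n * f $ n"
  by (simp add: rot_def)

lemma rot_simps [simp]: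
  fixes f g :: "'r::idom fps"
  shows "rot w (f * g) = rot w f * rot w g" "rot w (f - g) = rot w f - rot w g"
    "rot w (f ^ n) = rot w f ^ n" "rot w 1 = 1" "rot w fps_X = fps_const w * fps_X"
    "rot w (numeral k) = numeral k"
  by (simp_all add: rot_def fps_compose_mult_distrib fps_compose_sub_distrib fps_compose_power)

lemma rot_dil:
  assumes "w ^ 3 = 1"
  shows "rot w (dil f) = dil f"
  by (rule fps_ext) (auto simp: rot_nth dil_nth power_mult assms)

lemma agree_rot: "agree M f g \<Longrightarrow> agree M (rot w f) (rot w g)"
  by (simp add: agree_def rot_nth)

text \<open>The rotations of 1 - q^i multiply to 1 - q^(3 i) if 3 does not divide i, and to (1 -
  q^i)^3 if it does. The step from \<open>K\<close> to \<open>Suc K\<close> adds one block of three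
  consecutive exponents.\<close>

lemma euler_prod_norm:
  fixes w :: "'r::idom"
  assumes w: "w ^ 2 + w + 1 = 0"
  shows "(euler_prod (3 * K) * (rot w (euler_prod (3 * K)) * rot (w ^ 2) (euler_prod (3 * K)))) *
      dil (dil (euler_prod K)) = dil (euler_prod K) ^ 3 * dil (euler_prod (3 * K) :: 'r fps)"
proof (induction K)
  case (Suc K)
  have w3: "w ^ 3 = 1" using w by algebra
  have w6: "(w ^ 2) ^ 3 = 1" using w3 by algebra
  have wK: "w ^ (3 * K) = 1" "(w ^ 2) ^ (3 * K) = 1"
    unfolding power_mult w3 w6 by simp_all
  define z :: "nat \<Rightarrow> 'r fps" where "z i = fps_X ^ (3 * K + i)" for i
  let ?w = "fps_const w" and ?w2 = "fps_const (w ^ 2)"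
  have e: "euler_prod (3 * Suc K) = euler_prod (3 * K) * ((1 - z 1) * (1 - z 2) * (1 - z 3))"
    by (simp add: euler_prod_Suc numeral_3_eq_3 numeral_2_eq_2 z_def mult.assoc)
  have rot_z: "rot u (z i) = fps_const (u ^ i) * z i" if "u ^ (3 * K) = 1" for u i
    by (simp add: z_def power_mult_distrib power_add that fps_const_power)
  have w': "?w2 + ?w + 1 = 0"
    using arg_cong [OF w, of fps_const] by (simp flip: fps_const_add)
  have sq: "?w2 = ?w ^ 2" by (simp add: fps_const_power)
  have pow: "fps_const (w ^ 1) = ?w" "fps_const (w ^ 3) = 1" "fps_const ((w ^ 2) ^ 1) = ?w2"
    "fps_const ((w ^ 2) ^ 2) = ?w" "fps_const ((w ^ 2) ^ 3) = 1"
    using w3 by (simp_all flip: power_mult) (simp_all add: power_numeral_reduce)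
  have f1: "(1 - y) * ((1 - ?w * y) * (1 - ?w2 * y)) = 1 - y ^ 3"
   and f2: "(1 - y) * ((1 - ?w2 * y) * (1 - ?w * y)) = 1 - y ^ 3" for y
    using w' unfolding sq by algebra+
  have dz: "dil (z i) = z i ^ 3" for i
    by (simp add: z_def flip: power_mult)
  have z3: "dil (fps_X ^ Suc K) = z 3"
    by (simp add: z_def power_mult [symmetric] algebra_simps del: power_Suc)
  let ?e = "euler_prod (3 * K) * (rot w (euler_prod (3 * K)) * rot (w ^ 2) (euler_prod (3 * K))) :: 'r fps"
  have "euler_prod (3 * Suc K) * (rot w (euler_prod (3 * Suc K)) * rot (w ^ 2) (euler_prod (3 * Suc K)))
    = ?e * (((1 - z 1) * ((1 - ?w * z 1) * (1 - ?w2 * z 1))) * ((1 - z 2) * ((1 - ?w2 * z 2) * (1 - ?w * z 2)))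
        * (1 - z 3) ^ 3)"
    unfolding e by (simp only: rot_simps rot_z wK pow) (simp add: power3_eq_cube ac_simps)
  also have "\<dots> = ?e * ((1 - z 1 ^ 3) * (1 - z 2 ^ 3) * (1 - z 3) ^ 3)"
    unfolding f1 f2 by simp
  finally have "euler_prod (3 * Suc K) * (rot w (euler_prod (3 * Suc K)) * rot (w ^ 2) (euler_prod (3 * Suc K)))
     * dil (dil (euler_prod (Suc K)))
    = (?e * dil (dil (euler_prod K))) * ((1 - z 1 ^ 3) * (1 - z 2 ^ 3) * (1 - z 3 ^ 3)) * (1 - z 3) ^ 3"
    by (simp add: euler_prod_Suc z3 dz ac_simps del: power_Suc dil_simps(4))
  also have "\<dots> = dil (euler_prod (Suc K)) ^ 3 * dil (euler_prod (3 * Suc K))"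
    unfolding Suc.IH e by (simp add: euler_prod_Suc z3 dz power_mult_distrib ac_simps del: power_Suc dil_simps(4))
  finally show ?case .
qed simp

lemma euler_norm:
  fixes w :: "'r::idom"
  assumes "w ^ 2 + w + 1 = 0"
  shows "(euler * (rot w euler * rot (w ^ 2) euler)) * dil (dil euler) = dil (euler :: 'r fps) ^ 4"
proof (rule agree_imp_eq)
  fix M
  have E: "agree M euler (euler_prod n :: 'r fps)" if "M \<le> n" for n
    by (rule agree_mono [OF agree_euler]) (use that in simp)
  have E3: "agree M euler (euler_prod (3 * M) :: 'r fps)" and E1: "agree M euler (euler_prod M :: 'r fps)"
    by (rule E; simp)+
  have "agree M ((euler * (rot w euler * rot (w ^ 2) euler)) * dil (dil euler))
    ((euler_prod (3 * M) * (rot w (euler_prod (3 * M)) * rot (w ^ 2) (euler_prod (3 * M)))) *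
      dil (dil (euler_prod M)))"
    by (intro agree_mult agree_rot agree_dil E3 E1)
  also have "\<dots> = (dil (euler_prod M) * dil (euler_prod M)) * (dil (euler_prod M) * dil (euler_prod (3 * M)))"
    unfolding euler_prod_norm [OF assms] by (simp add: power3_eq_cube mult.assoc)
  also have "agree M \<dots> ((dil euler * dil euler) * (dil euler * dil euler))"
    by (intro agree_mult agree_dil agree_sym [OF E3] agree_sym [OF E1])
  finally show "agree M ((euler * (rot w euler * rot (w ^ 2) euler)) * dil (dil euler)) (dil euler ^ 4)"
    by (simp add: power4_eq_xxxx mult.assoc)
qed

text \<open>Rotation q -> w q fixes x and sends y to w y, so the three rotations of E^3 = E(q^3) (x
  - y) multiply to E(q^3)^3 (x^3 - y^3); the left side is evaluated by
  \<open>euler_norm\<close>.\<close>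

lemma cubic_norm:
  fixes w :: "'r::idom"
  assumes w: "w ^ 2 + w + 1 = 0"
  shows "dil (euler :: 'r fps) ^ 9 = (dil cubic_a ^ 3 - (3 * fps_X * dil cubic_c) ^ 3) * dil (dil euler) ^ 3"
proof -
  have w3: "w ^ 3 = 1" using w by algebra
  have w6: "(w ^ 2) ^ 3 = 1" using w3 by algebra
  let ?E = "euler :: 'r fps" and ?x = "dil cubic_a :: 'r fps" and ?y = "3 * fps_X * dil cubic_c :: 'r fps"
  let ?w = "fps_const w"
  have w': "?w ^ 2 + ?w + 1 = 0"
    using arg_cong [OF w, of fps_const] by (simp add: fps_const_power flip: fps_const_add)
  have 0: "?E ^ 3 = dil ?E * (?x - ?y)" by (rule euler_cube [OF w])
  have 1: "rot w ?E ^ 3 = dil ?E * (?x - ?w * ?y)"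
    using arg_cong [OF 0, of "rot w"] by (simp add: rot_dil [OF w3] mult_ac)
  have 2: "rot (w ^ 2) ?E ^ 3 = dil ?E * (?x - ?w ^ 2 * ?y)"
    using arg_cong [OF 0, of "rot (w ^ 2)"] by (simp add: rot_dil [OF w6] mult_ac fps_const_power)
  have "dil ?E ^ 3 * dil ?E ^ 9 = (dil ?E ^ 4) ^ 3"
    by (simp flip: power_mult power_add)
  also have "\<dots> = (?E ^ 3 * (rot w ?E ^ 3 * rot (w ^ 2) ?E ^ 3)) * dil (dil ?E) ^ 3"
    unfolding euler_norm [OF w, symmetric] by (simp add: power_mult_distrib)
  also have "?E ^ 3 * (rot w ?E ^ 3 * rot (w ^ 2) ?E ^ 3)
      = dil ?E ^ 3 * ((?x - ?y) * ((?x - ?w * ?y) * (?x - ?w ^ 2 * ?y)))"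
    unfolding 0 1 2 by (simp add: power3_eq_cube ac_simps)
  also have "(?x - ?y) * ((?x - ?w * ?y) * (?x - ?w ^ 2 * ?y)) = ?x ^ 3 - ?y ^ 3"
    using w' by algebra
  finally have "dil ?E ^ 3 * dil ?E ^ 9 = dil ?E ^ 3 * ((?x ^ 3 - ?y ^ 3) * dil (dil ?E) ^ 3)"
    by (simp add: mult.assoc)
  moreover have "dil ?E \<noteq> 0"
  proof
    assume "dil ?E = 0"
    then have "dil ?E $ 0 = 0" by simp
    then show False by (simp add: dil_nth)
  qed
  ultimately show ?thesis by (metis mult_cancel_left power_not_zero)
qed

text \<open>The root of unity occurs in the proofs but not in the resulting identities, so they
  descend along this injective embedding.\<close>

definition cfps :: "int fps \<Rightarrow> complex fps" where
  "cfps f = Abs_fps (\<lambda>n. of_int (f $ n))"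

lemma cfps_nth [simp]: "cfps f $ n = of_int (f $ n)"
  by (simp add: cfps_def)

lemma cfps_mult: "cfps (f * g) = cfps f * cfps g"
  by (rule fps_ext) (simp add: fps_mult_nth)

lemma cfps_simps [simp]:
  "cfps (f * g) = cfps f * cfps g" "cfps (f - g) = cfps f - cfps g" "cfps 1 = 1" "cfps fps_X = fps_X"
  "cfps (numeral k) = numeral k" "cfps (f ^ n) = cfps f ^ n" "cfps (dil f) = dil (cfps f)"
  "cfps (gf S w) = gf S w"
proof -
  show 1: "cfps 1 = 1" by (rule fps_ext) (simp add: fps_one_nth)
  show "cfps (f ^ n) = cfps f ^ n" by (induction n) (simp_all add: 1 cfps_mult)
qed (rule fps_ext; simp add: cfps_mult fps_X_def numeral_fps_const dil_nth gf_nth)+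

lemma cfps_inj: "cfps f = cfps g \<Longrightarrow> f = g"
  by (auto simp: fps_eq_iff)

lemma cfps_euler [simp]: "cfps euler = euler"
proof -
  have "cfps (euler_prod n) = euler_prod n" for n
    by (induction n) (simp_all add: euler_prod_Suc del: power_Suc)
  then have "of_int (euler_prod n $ n) = (euler_prod n $ n :: complex)" for n
    by (metis cfps_nth)
  then show ?thesis
    by (intro fps_ext) (simp add: euler_def)
qed

lemma complex_cube_root: "\<exists>w :: complex. w ^ 2 + w + 1 = 0"
proof
  show "(Complex (- 1 / 2) (sqrt 3 / 2)) ^ 2 + Complex (- 1 / 2) (sqrt 3 / 2) + 1 = 0"
    by (simp add: complex_eq_iff power2_eq_square field_simps)
qed

lemma euler_cube_int: "(euler :: int fps) ^ 3 = dil euler * (dil cubic_a - 3 * fps_X * dil cubic_c)"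
proof (rule cfps_inj)
  obtain w :: complex where "w ^ 2 + w + 1 = 0" using complex_cube_root by blast
  from euler_cube [OF this] show "cfps (euler ^ 3) = cfps (dil euler * (dil cubic_a - 3 * fps_X * dil cubic_c))"
    by (simp add: cubic_c_def)
qed

lemma cubic_norm_int:
  "dil (euler :: int fps) ^ 9 = (dil cubic_a ^ 3 - (3 * fps_X * dil cubic_c) ^ 3) * dil (dil euler) ^ 3"
proof (rule cfps_inj)
  obtain w :: complex where "w ^ 2 + w + 1 = 0" using complex_cube_root by blast
  from cubic_norm [OF this] show "cfps (dil euler ^ 9) =
      cfps ((dil cubic_a ^ 3 - (3 * fps_X * dil cubic_c) ^ 3) * dil (dil euler) ^ 3)"
    by (simp add: cubic_c_def)
qed

lemma cubic_c_0: "(cubic_c :: int fps) $ 0 = 1"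
proof -
  have "{p \<in> tri_mod (- 1) 0. w3 p = 0} = {(0, 0, - 1)}"
  proof (intro equalityI subsetI)
    fix p assume p: "p \<in> {p \<in> tri_mod (- 1) 0. w3 p = 0}"
    obtain x y z where xyz: "p = (x, y, z)" by (rule prod_cases3)
    have "tr x + tr y + tr z = 0" using p by (simp add: xyz w3_def)
    then have "- 1 \<le> x \<and> x \<le> 0" "- 1 \<le> y \<and> y \<le> 0"
      using tr_bounds [of x] tr_bounds [of y] tr_bounds [of z] by linarith+
    then have "x \<in> {- 1, 0}" "y \<in> {- 1, 0}" by auto
    then show "p \<in> {(0, 0, - 1)}"
      using p xyz by (auto simp: tri_mod_def w3_def tr_def)
  qed (simp add: tri_mod_def w3_def tr_def)
  then show ?thesis by (simp add: cubic_c_def gf_nth)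
qed

definition partition_gf :: "int fps" where "partition_gf = (SOME v. euler * v = 1)"

lemma euler_partition_gf: "euler * partition_gf = 1"
  unfolding partition_gf_def by (rule someI_ex) (simp add: unit_fps)

interpretation cubic: cubic_theta euler partition_gf cubic_a cubic_c
proof
  show "euler * partition_gf = 1" by (rule euler_partition_gf)
  show "cubic_a = dil cubic_a + 2 * (3 * fps_X * dil cubic_c :: int fps)"
    using gf_tri_mod [of 0, where ?'r = int]
    by (simp add: gf_tri_0_mod_0 gf_tri_0_mod_1 gf_tri_0_mod_2 add.commute)
  show "euler ^ 3 = dil euler * (dil cubic_a - 3 * fps_X * dil cubic_c :: int fps)"
    by (rule euler_cube_int)
  have dil_inv: "dil euler * dil partition_gf = 1"
    using arg_cong [OF euler_partition_gf, of dil] by simp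
  have "dil (euler ^ 3 * dil partition_gf) ^ 3 = dil euler ^ 9 * dil (dil partition_gf) ^ 3"
    by (simp add: power_mult_distrib flip: power_mult)
  also have "\<dots> = (dil cubic_a ^ 3 - (3 * fps_X * dil cubic_c) ^ 3) * dil (dil euler * dil partition_gf) ^ 3"
    unfolding cubic_norm_int by (simp add: power_mult_distrib mult.assoc)
  finally show "dil cubic_a ^ 3 - (3 * fps_X * dil cubic_c) ^ 3 = dil (euler ^ 3 * dil partition_gf) ^ 3"
    by (simp add: dil_inv)
  show "euler $ 0 = (1 :: int)" by simp
  show "cubic_c $ 0 = (1 :: int)" by (rule cubic_c_0)
qed

text \<open>The coefficients 54 = 2 * 27 and 162 = 2 * 27 * 3 are just what is needed to absorb 27 q
  C^3 = a^3 - b^3 and y = 3 q C(q^3), after which only forms in x and y remain.\<close>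

lemma form_nonary: "cubic.form 4 (gf nonary w9)"
proof -
  let ?a = "cubic_a :: int fps" and ?C = "cubic_c :: int fps"
  have "gf nonary w9 = ?a ^ 3 * cubic.x + 2 * ?a * (27 * fps_X * ?C ^ 3) + 2 * (27 * fps_X * ?C ^ 3) * cubic.y"
    unfolding gf_nonary cubic.x_def cubic.y_def by simp algebra
  also have "27 * fps_X * ?C ^ 3 = ?a ^ 3 + of_int (- 1) * cubic.b ^ 3"
    using cubic.cubes by simp
  finally have eq: "gf nonary w9 = ?a ^ 3 * cubic.x + (of_int 2 * ?a) * (?a ^ 3 + of_int (- 1) * cubic.b ^ 3)
      + (of_int 2 * (?a ^ 3 + of_int (- 1) * cubic.b ^ 3)) * cubic.y" by simp
  have d: "cubic.form 3 (?a ^ 3 + of_int (- 1) * cubic.b ^ 3)"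
    using cubic.form.add [OF cubic.form_power [OF cubic.form_a, of 3]
        cubic.form_scale [OF cubic.form_power [OF cubic.form_b, of 3], of "- 1"]] by simp
  show ?thesis
    unfolding eq
    using cubic.form_mult [OF cubic.form_power [OF cubic.form_a, of 3] cubic.form_x]
      cubic.form_mult [OF cubic.form_scale [OF cubic.form_a, of 2] d]
      cubic.form_mult [OF cubic.form_scale [OF d, of 2] cubic.form_y]
    by (intro cubic.form.add) simp_all
qed

section \<open>Frobenius partitions\<close>

lemma gfp_row_iff: "gfp_row k xs \<longleftrightarrow> set xs \<subseteq> colored_nats k \<and> sorted_wrt (<) (rev xs)"
proof -
  have "x \<prec> y \<longleftrightarrow> x < y" for x y
    by (auto simp: colored_less_def less_prod_def less_prod_simp less_le_not_le split: prod.splits)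
  then show ?thesis by (simp add: gfp_row_def sorted_wrt_rev)
qed

lemma bij_betw_gfp_rows: "bij_betw set {xs. gfp_row k xs} {A. finite A \<and> A \<subseteq> colored_nats k}"
proof (rule bij_betwI [where g = "\<lambda>A. rev (sorted_list_of_set A)"])
  fix xs assume "xs \<in> {xs. gfp_row k xs}"
  then have "sorted_list_of_set (set (rev xs)) = rev xs"
    by (simp only: mem_Collect_eq gfp_row_iff strict_sorted_iff)
      (metis sorted_list_of_set.idem_if_sorted_distinct)
  then show "rev (sorted_list_of_set (set xs)) = xs" by simp
qed (auto simp: gfp_row_iff)

lemma gfp_row_distinct: "gfp_row k xs \<Longrightarrow> distinct xs"
  by (simp add: gfp_row_iff strict_sorted_iff)

lemma sum_nth_distinct:
  assumes "distinct xs"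
  shows "(\<Sum>i<length xs. f (xs ! i)) = sum f (set xs)"
proof -
  have "sum f (set xs) = sum_list (map f xs)"
    using assms by (simp add: sum_list_distinct_conv_sum_set)
  also have "\<dots> = (\<Sum>i<length xs. f (xs ! i))"
    by (simp add: sum_list_sum_nth atLeast0LessThan)
  finally show ?thesis by simp
qed

text \<open>Strictly decreasing rows are finite sets, and the summand r is charged to the top row as
  \<open>Suc\<close>. Every entry is then at most \<open>n\<close>, so the sets fit into a finite
  box.\<close>

lemma cphi_eq_card:
  assumes "n < N"
  shows "cphi k n = card {(A, B). A \<subseteq> {..<N} \<times> {1..k} \<and> B \<subseteq> {..<N} \<times> {1..k} \<and>
    card A = card B \<and> (\<Sum>x\<in>A. Suc (fst x)) + sum fst B = n}"
proof -
  let ?T = "{(A, B). A \<subseteq> {..<N} \<times> {1..k} \<and> B \<subseteq> {..<N} \<times> {1..k} \<and>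
    card A = card B \<and> (\<Sum>x\<in>A. Suc (fst x)) + sum fst B = n}"
  let ?F = "{A. finite A \<and> A \<subseteq> colored_nats k}"
  let ?Q = "\<lambda>(A, B). card A = card B \<and> (\<Sum>x\<in>A. Suc (fst x)) + sum fst B = n"
  have bij: "bij_betw (map_prod set set) {p \<in> {xs. gfp_row k xs} \<times> {xs. gfp_row k xs}. ?Q (map_prod set set p)}
      {q \<in> ?F \<times> ?F. ?Q q}"
    by (rule bij_betw_filter [OF bij_betw_map_prod [OF bij_betw_gfp_rows bij_betw_gfp_rows]])
  have rows: "{p \<in> {xs. gfp_row k xs} \<times> {xs. gfp_row k xs}. ?Q (map_prod set set p)}
      = gen_frobenius_partitions k n"
  proof -
    have "?Q (map_prod set set (as, bs)) \<longleftrightarrow> length as = length bs \<and>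
        n = length as + (\<Sum>i<length as. fst (as ! i) + fst (bs ! i))"
      if "gfp_row k as" "gfp_row k bs" for as bs
    proof -
      have d: "distinct as" "distinct bs" using that by (auto dest: gfp_row_distinct)
      then have "card (set as) = length as" "card (set bs) = length bs"
        by (auto simp: distinct_card)
      moreover have "(\<Sum>x\<in>set as. Suc (fst x)) = length as + sum fst (set as)"
        using d by (simp add: sum_Suc distinct_card)
      moreover have "(\<Sum>i<length as. fst (as ! i) + fst (bs ! i)) = sum fst (set as) + sum fst (set bs)"
        if "length as = length bs"
        using sum_nth_distinct [OF d(1), of fst] sum_nth_distinct [OF d(2), of fst] that
        by (simp add: sum.distrib)
      ultimately show ?thesis by auto
    qed
    then show ?thesis
      unfolding gen_frobenius_partitions_def by fastforce
  qed
  have sets: "{q \<in> ?F \<times> ?F. ?Q q} = ?T"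
  proof (intro equalityI subsetI)
    fix q assume "q \<in> {q \<in> ?F \<times> ?F. ?Q q}"
    then obtain A B where q: "q = (A, B)" "finite A" "finite B" "A \<subseteq> colored_nats k" "B \<subseteq> colored_nats k"
      "card A = card B" "(\<Sum>x\<in>A. Suc (fst x)) + sum fst B = n" by auto
    have "fst x < N" if "x \<in> A" for x
      using member_le_sum [of x A "\<lambda>x. Suc (fst x)"] that q assms by simp
    moreover have "fst x < N" if "x \<in> B" for x
      using member_le_sum [of x B fst] that q assms by simp
    ultimately have "A \<subseteq> {..<N} \<times> {1..k}" "B \<subseteq> {..<N} \<times> {1..k}"
      using q(4,5) by (auto simp: colored_nats_def)
    then show "q \<in> ?T"
      using q by simp
  next
    fix q assume "q \<in> ?T"
    then obtain A B where q: "q = (A, B)" "A \<subseteq> {..<N} \<times> {1..k}" "B \<subseteq> {..<N} \<times> {1..k}"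
      "card A = card B" "(\<Sum>x\<in>A. Suc (fst x)) + sum fst B = n" by auto
    then have "finite A" "finite B" by (auto intro: finite_subset)
    moreover have "A \<subseteq> colored_nats k" "B \<subseteq> colored_nats k"
      using q(2,3) by (auto simp: colored_nats_def)
    ultimately show "q \<in> {q \<in> ?F \<times> ?F. ?Q q}"
      using q(1,4,5) by simp
  qed
  show ?thesis
    unfolding cphi_def using bij_betw_same_card [OF bij] by (simp only: rows sets)
qed

text \<open>The top row collects the first factors that contribute \<open>z q\<^sup>n\<^sup>+\<^sup>1\<close>, the bottom row the second
  factors that contribute \<open>q\<^sup>n\<close> instead of \<open>z\<close>.\<close>

lemma coeff_theta_prod_power:
  assumes "n < N"
  shows "coeff (theta_prod N ^ k) (k * N) $ n = (of_nat (cphi k n) :: 'r::comm_ring_1)"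
proof -
  let ?I = "{..<N} \<times> {1..k}"
  let ?w = "\<lambda>(A, B). int ((\<Sum>x\<in>A. Suc (fst x)) + sum fst B)"
  let ?d = "\<lambda>(A, B). card A + card (?I - B)"
  have fin: "finite A" if "A \<in> Pow ?I" for A
    using that by (auto intro: finite_subset)
  have const: "(\<Prod>x\<in>A. monom (f x) 0) = monom (\<Prod>x\<in>A. f x) 0"
    and lin: "(\<Prod>x\<in>A. monom (f x) 1) = monom (\<Prod>x\<in>A. f x) (card A)"
    if "finite A" for A :: "(nat \<times> nat) set" and f :: "nat \<times> nat \<Rightarrow> 'r fps"
    using that by (induction A rule: finite_induct) (simp_all add: mult_monom monom_0)
  have "theta_prod N ^ k = (\<Prod>x\<in>?I. [:1, fps_X ^ Suc (fst x):] * [:fps_X ^ fst x, 1:] :: 'r fps poly)"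
  proof -
    have "(\<Prod>x\<in>?I. g (fst x)) = (\<Prod>n<N. \<Prod>c\<in>{1..k}. g n)" for g :: "nat \<Rightarrow> 'r fps poly"
      unfolding prod.cartesian_product by (simp add: case_prod_unfold)
    then have *: "(\<Prod>x\<in>?I. g (fst x)) = (\<Prod>n<N. g n) ^ k" for g :: "nat \<Rightarrow> 'r fps poly"
      by (simp add: prod_power_distrib)
    show ?thesis unfolding theta_prod_def by (rule * [symmetric])
  qed
  also have "\<dots> = (\<Prod>x\<in>?I. monom (fps_X ^ Suc (fst x)) 1 + monom 1 0) * (\<Prod>x\<in>?I. monom (fps_X ^ fst x) 0 + monom 1 1)"
    unfolding prod.distrib by (simp add: monom_altdef numeral_eq_Suc)
  also have "(\<Prod>x\<in>?I. monom (fps_X ^ Suc (fst x)) 1 + monom 1 0)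
      = (\<Sum>A\<in>Pow ?I. monom (fps_X ^ (\<Sum>x\<in>A. Suc (fst x))) (card A) :: 'r fps poly)"
    by (subst prod_add) (auto intro!: sum.cong simp: const lin lin [unfolded One_nat_def] fin mult_monom power_sum simp del: power_Suc)
  also have "(\<Prod>x\<in>?I. monom (fps_X ^ fst x) 0 + monom 1 1)
      = (\<Sum>B\<in>Pow ?I. monom (fps_X ^ (sum fst B)) (card (?I - B)) :: 'r fps poly)"
    by (subst prod_add) (auto intro!: sum.cong simp: const monom_power fin mult_monom power_sum)
  finally have "theta_prod N ^ k = wt (Pow ?I \<times> Pow ?I) (\<lambda>p. 1 :: 'r) ?w ?d"
    unfolding sum_monom_mult wt_def
    by (simp add: case_prod_unfold power_add del: of_nat_add of_nat_sum)
  then have "coeff (theta_prod N ^ k) (k * N) $ n =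
      (\<Sum>p\<in>{p \<in> Pow ?I \<times> Pow ?I. ?d p = k * N \<and> ?w p = int n}. 1 :: 'r)"
    by (simp only:) (rule coeff_wt; auto simp del: of_nat_add of_nat_sum)
  also have "{p \<in> Pow ?I \<times> Pow ?I. ?d p = k * N \<and> ?w p = int n} =
      {(A, B). A \<subseteq> ?I \<and> B \<subseteq> ?I \<and> card A = card B \<and> (\<Sum>x\<in>A. Suc (fst x)) + sum fst B = n}"
  proof -
    \<comment> \<open>Here the balance of the two rows becomes a power of z: the box has k N
      elements, so exponent k N, that is z^0 after normalisation, means equally many
      entries.\<close>
    have "card A + card (?I - B) = k * N \<longleftrightarrow> card A = card B" if "B \<subseteq> ?I" for A B :: "(nat \<times> nat) set"
    proof -
      have "card (?I - B) = N * k - card B" "card B \<le> N * k"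
        using that card_mono [of ?I B] by (simp_all add: card_Diff_subset finite_subset)
      then show ?thesis by (simp add: mult.commute) linarith
    qed
    then show ?thesis by (auto simp del: of_nat_add of_nat_sum)
  qed
  finally show ?thesis
    by (simp add: cphi_eq_card [OF assms])
qed

text \<open>Both sides are the z^0 coefficient of the ninth power of the triple product: the product
  side counts Frobenius arrays, the sum side counts vectors of Z^9 with coordinate sum 0.\<close>

theorem cphi9_gf: "Abs_fps (\<lambda>n. int (cphi 9 n)) = gf nonary w9 * partition_gf ^ 9"
proof -
  let ?\<Phi> = "Abs_fps (\<lambda>n. int (cphi 9 n))"
  have "euler ^ 9 * ?\<Phi> = gf nonary w9"
  proof (rule agree_imp_eq)
    fix M
    define N :: nat where "N = 2 * M + 1"
    let ?I = "{- int N..int N}"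
    let ?H = "theta_prod N :: int fps poly" and ?T = "theta_sum N :: int fps poly"
    have "pagree M (smult euler ?H ^ 9) (?T ^ 9)"
      by (rule pagree_power [OF jacobi_triple]) (simp add: N_def)
    then have 1: "agree M (euler ^ 9 * coeff (?H ^ 9) (9 * N)) (coeff (?T ^ 9) (9 * N))"
      by (simp add: pagree_def smult_power)
    have "agree M ?\<Phi> (coeff (?H ^ 9) (9 * N))"
      unfolding agree_def
    proof (intro allI impI)
      fix i assume "i < M"
      then have "i < N" by (simp add: N_def)
      then show "?\<Phi> $ i = coeff (?H ^ 9) (9 * N) $ i" by (simp add: coeff_theta_prod_power)
    qed
    then have 2: "agree M (euler ^ 9 * ?\<Phi>) (euler ^ 9 * coeff (?H ^ 9) (9 * N))"
      by (rule agree_mult [OF agree_refl])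
    have 3: "agree M (coeff (?T ^ 9) (9 * N)) (gf nonary w9)"
      unfolding agree_def
    proof (intro allI impI)
      fix n assume "n < M"
      then have range: "n < N" by (simp add: N_def)
      let ?d3 = "\<lambda>(x, y, z). nat (x + int N) + (nat (y + int N) + nat (z + int N))"
      let ?w3 = "\<lambda>(x, y, z). tr x + (tr y + tr z)"
      let ?d9 = "\<lambda>(p, q, r). ?d3 p + (?d3 q + ?d3 r)" and ?w9 = "\<lambda>(p, q, r). ?w3 p + (?w3 q + ?w3 r)"
      let ?J = "?I \<times> ?I \<times> ?I"
      have T3: "?T * (?T * ?T) = wt ?J (\<lambda>p. 1) ?w3 ?d3"
        unfolding theta_sum_wt by (simp add: wt_mult tr_bounds case_prod_unfold)
      have "?T ^ 9 = (?T * (?T * ?T)) * ((?T * (?T * ?T)) * (?T * (?T * ?T)))"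
        by (simp add: numeral_eq_Suc mult.assoc)
      also have "\<dots> = wt (?J \<times> ?J \<times> ?J) (\<lambda>p. 1) ?w9 ?d9"
        unfolding T3 by (subst wt_mult wt_mult; auto simp: tr_bounds case_prod_unfold intro!: add_nonneg_nonneg)+
      finally have "coeff (?T ^ 9) (9 * N) $ n
          = (\<Sum>p\<in>{p \<in> ?J \<times> ?J \<times> ?J. ?d9 p = 9 * N \<and> ?w9 p = int n}. 1)"
        by (simp only:) (rule coeff_wt; auto simp: tr_bounds)
      also have "{p \<in> ?J \<times> ?J \<times> ?J. ?d9 p = 9 * N \<and> ?w9 p = int n} = {p \<in> nonary. w9 p = int n}" (is "?L = ?R")
      proof (intro equalityI subsetI)
        fix p assume p: "p \<in> ?L"
        obtain a b c d e f g h i where abc: "p = ((a, b, c), (d, e, f), (g, h, i))" by (metis prod_cases3)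
        have "int (?d9 p) = int (9 * N)" using p by simp
        then have "a + b + c + (d + e + f) + (g + h + i) = 0"
          using p by (simp add: abc)
        then show "p \<in> ?R" using p by (simp add: abc nonary_def w9_def w3_def add.assoc)
      next
        fix p assume p: "p \<in> ?R"
        obtain a b c d e f g h i where abc: "p = ((a, b, c), (d, e, f), (g, h, i))" by (metis prod_cases3)
        have w: "w3 (a, b, c) + (w3 (d, e, f) + w3 (g, h, i)) = int n"
          and sum: "a + b + c + (d + e + f) + (g + h + i) = 0"
          using p by (simp_all add: abc w9_def nonary_def)
        have "w3 q = int (nat (w3 q))" for q using w3_nonneg [of q] by simp
        moreover have "nat (w3 (a, b, c)) < N" "nat (w3 (d, e, f)) < N" "nat (w3 (g, h, i)) < N"
          using w w3_nonneg [of "(a, b, c)"] w3_nonneg [of "(d, e, f)"] w3_nonneg [of "(g, h, i)"] range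
          by linarith+
        ultimately have r: "a \<in> ?I" "b \<in> ?I" "c \<in> ?I" "d \<in> ?I" "e \<in> ?I" "f \<in> ?I" "g \<in> ?I" "h \<in> ?I" "i \<in> ?I"
          by (metis w3_range)+
        then have "int (?d9 p) = int (9 * N)"
          using sum by (simp add: abc)
        then have "?d9 p = 9 * N" by (simp only: of_nat_eq_iff)
        moreover have "?w9 p = int n"
          using w by (simp only: abc w3_def prod.case add.assoc)
        moreover have "p \<in> ?J \<times> ?J \<times> ?J"
          using r by (simp only: abc mem_Sigma_iff)
        ultimately show "p \<in> ?L" by (simp only: mem_Collect_eq)
      qed
      finally show "coeff (?T ^ 9) (9 * N) $ n = gf nonary w9 $ n"
        by (simp add: gf_nth)
    qed
    show "agree M (euler ^ 9 * ?\<Phi>) (gf nonary w9)"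
      using agree_trans [OF agree_trans [OF 2 1] 3] .
  qed
  then have "gf nonary w9 * partition_gf ^ 9 = (euler * partition_gf) ^ 9 * ?\<Phi>"
    by (simp add: power_mult_distrib mult_ac)
  then show ?thesis by (simp add: euler_partition_gf)
qed

lemma cong_0_of_int_dvd:
  assumes "(3 :: int) ^ m dvd int c" "l \<le> m"
  shows "[c = 0] (mod 3 ^ l)"
proof -
  have "int (3 ^ l) dvd int c"
    using dvd_trans [OF le_imp_power_dvd [OF assms(2), of "3 :: int"] assms(1)] by simp
  then show ?thesis by (simp only: int_dvd_int_iff cong_0_iff)
qed

theorem theorem1p4:
  fixes k n :: nat
  assumes "k \<ge> 3"
  shows
    "[cphi 9 (3 ^ (2 * k + 1) * n + (7 * 3 ^ (2 * k + 1) + 3) div 8) = 0] (mod 3 ^ (4 * k + 5)) \<and>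
     [cphi 9 (3 ^ (2 * k + 2) * n + (5 * 3 ^ (2 * k + 2) + 3) div 8) = 0] (mod 3 ^ (4 * k + 6)) \<and>
     [cphi 9 (3 ^ (2 * k + 2) * n + (23 * 3 ^ (2 * k + 1) + 3) div 8) = 0] (mod 3 ^ (4 * k + 7)) \<and>
     [cphi 9 (3 ^ (2 * k + 3) * n + (13 * 3 ^ (2 * k + 2) + 3) div 8) = 0] (mod 3 ^ (4 * k + 8))"
proof -
  note dvd = cubic.tower_dvd [OF form_nonary cphi9_gf]
  \<comment> \<open>The first and third progressions start from the residue-2 level of
    \<open>tower_dvd\<close>, whose power of 3 is \<open>2 * m + 3\<close>, hence the shift by one;
    the other two use \<open>k\<close> itself.\<close>
  obtain m where m: "k = m + 1" using assms by (metis add.commute le_Suc_ex one_add_one numeral_3_eq_3 plus_1_eq_Suc add_Suc)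
  have eqs: "2 * k + 1 = 2 * m + 3" "2 * k + 2 = 2 * m + 4" by (simp_all add: m)
  show ?thesis
  proof (intro conjI)
    show "[cphi 9 (3 ^ (2 * k + 1) * n + (7 * 3 ^ (2 * k + 1) + 3) div 8) = 0] (mod 3 ^ (4 * k + 5))"
      unfolding eqs by (rule cong_0_of_int_dvd [OF dvd(1)]) (use assms m in simp)
    show "[cphi 9 (3 ^ (2 * k + 2) * n + (5 * 3 ^ (2 * k + 2) + 3) div 8) = 0] (mod 3 ^ (4 * k + 6))"
      by (rule cong_0_of_int_dvd [OF dvd(2)]) (use assms in simp)
    show "[cphi 9 (3 ^ (2 * k + 2) * n + (23 * 3 ^ (2 * k + 1) + 3) div 8) = 0] (mod 3 ^ (4 * k + 7))"
      unfolding eqs by (rule cong_0_of_int_dvd [OF dvd(3)]) (use assms m in simp)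
    show "[cphi 9 (3 ^ (2 * k + 3) * n + (13 * 3 ^ (2 * k + 2) + 3) div 8) = 0] (mod 3 ^ (4 * k + 8))"
      by (rule cong_0_of_int_dvd [OF dvd(4)]) (use assms in simp)
  qed
qed

end
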